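(* There is a function $\varepsilon:\mathbb{N}\to\mathbb{R}$ with $\varepsilon(d)\to 0$ as $d\to\infty$ such that for every integer $g\ge 3$ and every positive integer $d$ there exists a finite diameter graph $G$ in $\mathbb{R}^d$ with girth at least $g$ and $\chi(G)\ge (1.107+\varepsilon(d))^{\sqrt{d}}$.
   Context: A graph $G$ is a diameter graph in $\mathbb{R}^d$ if there is an injective map $\phi:V(G)\to\mathbb{R}^d$ such that for any two adjacent vertices $u,v$, the distance $\|\phi(u)-\phi(v)\|$ equals the maximum distance $\max_{x,y\in V(G)}\|\phi(x)-\phi(y)\|$ (not every pair at maximum distance need be an edge). The girth of a graph is the length of its shortest cycle. $\chi(G)$ denotes the chromatic number. *)

theory Defs
  imports Complex_Main
begin

definition simple_graph :: "nat set \<Rightarrow> (nat \<Rightarrow> nat \<Rightarrow> bool) \<Rightarrow> bool" where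
  "simple_graph V E \<longleftrightarrow> (\<forall>u v. E u v \<longrightarrow> u \<in> V \<and> v \<in> V \<and> u \<noteq> v \<and> E v u)"

definition in_Rd :: "nat \<Rightarrow> (nat \<Rightarrow> real) \<Rightarrow> bool" where
  "in_Rd d x \<longleftrightarrow> (\<forall>i\<ge>d. x i = 0)"

definition edist :: "nat \<Rightarrow> (nat \<Rightarrow> real) \<Rightarrow> (nat \<Rightarrow> real) \<Rightarrow> real" where
  "edist d x y = sqrt (\<Sum>i<d. (x i - y i)^2)"

definition diameter_graph :: "nat \<Rightarrow> nat set \<Rightarrow> (nat \<Rightarrow> nat \<Rightarrow> bool) \<Rightarrow> bool" where
  "diameter_graph d V E \<longleftrightarrow>
     (\<exists>\<phi> :: nat \<Rightarrow> (nat \<Rightarrow> real).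
        (\<forall>v\<in>V. in_Rd d (\<phi> v)) \<and> inj_on \<phi> V \<and>
        (\<forall>u v. E u v \<longrightarrow>
           edist d (\<phi> u) (\<phi> v) = Max {edist d (\<phi> x) (\<phi> y) | x y. x \<in> V \<and> y \<in> V}))"

definition is_cycle :: "(nat \<Rightarrow> nat \<Rightarrow> bool) \<Rightarrow> nat list \<Rightarrow> bool" where
  "is_cycle E vs \<longleftrightarrow> length vs \<ge> 3 \<and> distinct vs \<and>
     (\<forall>i < length vs - 1. E (vs ! i) (vs ! Suc i)) \<and> E (last vs) (hd vs)"

text \<open>Girth at least g: no cycle of length less than g (acyclic graphs have infinite girth).\<close>
definition girth_ge :: "nat set \<Rightarrow> (nat \<Rightarrow> nat \<Rightarrow> bool) \<Rightarrow> nat \<Rightarrow> bool" where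
  "girth_ge V E g \<longleftrightarrow> (\<forall>vs. set vs \<subseteq> V \<and> is_cycle E vs \<longrightarrow> length vs \<ge> g)"

definition chromatic_number :: "nat set \<Rightarrow> (nat \<Rightarrow> nat \<Rightarrow> bool) \<Rightarrow> nat" where
  "chromatic_number V E = (LEAST k. \<exists>c :: nat \<Rightarrow> nat.
      (\<forall>v\<in>V. c v < k) \<and> (\<forall>u\<in>V. \<forall>v\<in>V. E u v \<longrightarrow> c u \<noteq> c v))"

end

theory Submission
  imports Defs "HOL-Analysis.Analysis" "HOL-Computational_Algebra.Primes" "HOL-Real_Asymp.Real_Asymp"
begin

text \<open>
  Consider vectors in \<open>{0, \<plusminus>1, \<plusminus>\<i>}^m\<close> with exactly \<open>q = 3^e\<close> nonzero entries, restricted to a class of fixed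
  parity of the number of imaginary and of negative entries. Two distinct members have inner product
  divisible by \<open>q\<close> only if they are orthogonal, so the Frankl--Wilson method bounds the sets without
  orthogonal pairs, and the orthogonality graph has chromatic number at least about \<open>1.155^m\<close>.
  Every orthogonal pair stays orthogonal when the coordinates are rotated by a common choice of angles
  \<open>t :: [m] \<rightarrow> [L]\<close>, and orthogonal members of a class have different supports. Hence the blow-up with
  vertices (vector, angles on its support) consists of many copies of the graph, two of which rarely share an
  edge, and adding edges one at a time, each killing a constant fraction of the surviving large independent
  sets while avoiding vertices of large degree and nearby pairs, gives a subgraph of large girth and the same
  chromatic bound. The symmetric square \<open>p \<mapsto> p \<otimes> p\<close> embeds it in dimension \<open>m (2 m + 1)\<close>, so that
  \<open>m \<approx> \<surd>(d / 2)\<close>, with orthogonal pairs at maximal distance.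
\<close>

section \<open>Greedy edge selection\<close>

text \<open>The dimension is fixed before the girth, so the base graph has boundedly many vertices
  and no thinning of it alone can combine large girth with high chromatic number. The number
  \<open>L\<close> of angles is the parameter that grows with \<open>g\<close>: it enlarges the
  vertex set without changing the dimension. One vertex fixes \<open>q\<close> angles, an orthogonal
  pair at least \<open>q + 1\<close>, so a given pair lies in fewer copies than a single vertex by a
  factor \<open>L\<close>; this makes short cycles avoidable. Independence is treated by density: a
  set holding a share \<open>1 / k\<close> of the blow-up contains an edge in a share of the samples
  that does not depend on \<open>L\<close>. Powers of 3 provide odd prime powers \<open>q\<close>
  without any information on the distribution of primes, but then \<open>q / m\<close> can only be
  placed in an interval whose ends have ratio 3. On the interval from 5/19 to 15/19 the estimates at
  the two ends are nearly equal and give the base 1.155. The constant 1.107 is just below 1.155 to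
  the power \<open>1 / sqrt 2\<close>.\<close>

lemma is_cycle_iff_mod:
  "is_cycle E vs \<longleftrightarrow> length vs \<ge> 3 \<and> distinct vs \<and>
     (\<forall>i < length vs. E (vs ! i) (vs ! (Suc i mod length vs)))"
proof (cases "length vs \<ge> 3")
  case True
  then obtain n where n: "length vs = Suc n" by (cases "length vs") auto
  have ne: "vs \<noteq> []" using n by auto
  have 1: "last vs = vs ! n" using n ne by (simp add: last_conv_nth)
  have 2: "hd vs = vs ! 0" using ne by (rule hd_conv_nth)
  have 3: "(\<forall>i < Suc n. E (vs ! i) (vs ! (Suc i mod Suc n))) \<longleftrightarrow>
      (\<forall>i < n. E (vs ! i) (vs ! Suc i)) \<and> E (vs ! n) (vs ! 0)"
    by (simp add: All_less_Suc conj_commute cong: imp_cong)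
  show ?thesis unfolding is_cycle_def n 1 2 3 by simp
qed (simp add: is_cycle_def)

lemma walk_imp_relpow:
  assumes "\<And>j. j < k \<Longrightarrow> (ws ! j, ws ! Suc j) \<in> R"
  shows "(ws ! 0, ws ! k) \<in> R ^^ k"
  unfolding relpow_fun_conv using assms by (intro exI[of _ "\<lambda>j. ws ! j"]) auto

lemma relpow_sym:
  assumes "sym R" "(u, v) \<in> R ^^ n"
  shows "(v, u) \<in> R ^^ n"
  using assms(2)
proof (induction n arbitrary: v)
  case (Suc n)
  then obtain w where "(u, w) \<in> R ^^ n" "(w, v) \<in> R" by auto
  with Suc.IH assms(1) show ?case
    by (meson relpow_Suc_I2 symE)
qed auto

text \<open>A cycle passes through the new edge at most once; deleting it there leaves a walk in
  \<open>R\<close> between \<open>u\<close> and \<open>v\<close> with one step less. Hence joining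
  vertices that are far apart creates no short cycle.\<close>

lemma cycle_insert_edge:
  assumes sym: "sym R"
    and cyc: "is_cycle (\<lambda>a b. (a, b) \<in> insert (u, v) (insert (v, u) R)) vs"
  shows "is_cycle (\<lambda>a b. (a, b) \<in> R) vs \<or> (u, v) \<in> R ^^ (length vs - 1)"
proof (cases "\<forall>i < length vs. (vs ! i, vs ! (Suc i mod length vs)) \<in> R")
  case True
  then show ?thesis using cyc by (simp add: is_cycle_iff_mod)
next
  case False
  define n where "n = length vs"
  have n3: "n \<ge> 3" and dist: "distinct vs"
    and edge: "\<And>i. i < n \<Longrightarrow> (vs ! i, vs ! (Suc i mod n)) \<in> insert (u, v) (insert (v, u) R)"
    using cyc by (auto simp: is_cycle_iff_mod n_def)
  obtain i where i: "i < n" "(vs ! i, vs ! (Suc i mod n)) \<notin> R"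
    using False by (auto simp: n_def)
  \<comment> \<open>Rotated so that the step outside \<open>R\<close> becomes the closing one, from
    the last vertex to the first.\<close>
  define ws where "ws = rotate (Suc i) vs"
  have len: "length ws = n" by (simp add: ws_def n_def)
  have wsd: "distinct ws" using dist by (simp add: ws_def)
  have nth: "ws ! j = vs ! ((Suc i + j) mod n)" if "j < n" for j
    using that unfolding ws_def n_def by (subst nth_rotate) auto
  have ends: "ws ! (n - 1) = vs ! i" "ws ! 0 = vs ! (Suc i mod n)"
    using nth[of "n - 1"] nth[of 0] i n3 by auto
  have uv: "{ws ! (n - 1), ws ! 0} = {u, v}"
    using edge[OF i(1)] i(2) unfolding ends by auto
  have "(ws ! j, ws ! Suc j) \<in> R" if j: "j < n - 1" for j
  proof (rule ccontr)
    assume notR: "(ws ! j, ws ! Suc j) \<notin> R"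
    have "ws ! Suc j = vs ! (Suc ((Suc i + j) mod n) mod n)"
      using nth[of "Suc j"] j by (simp add: mod_Suc_eq)
    moreover have "(Suc i + j) mod n < n" using n3 by simp
    ultimately have "(ws ! j, ws ! Suc j) \<in> insert (u, v) (insert (v, u) R)"
      using edge[of "(Suc i + j) mod n"] nth[of j] j by simp
    with notR have "ws ! j \<in> {ws ! (n - 1), ws ! 0}" "ws ! Suc j \<in> {ws ! (n - 1), ws ! 0}"
      unfolding uv by auto
    \<comment> \<open>Both indices lying in this set would force n = 2, but a cycle has at least 3
      vertices.\<close>
    then have "j \<in> {n - 1, 0}" "Suc j \<in> {n - 1, 0}"
      using wsd len j n3 by (auto simp: nth_eq_iff_index_eq)
    then show False using j n3 by auto
  qed
  then have "(ws ! 0, ws ! (n - 1)) \<in> R ^^ (n - 1)" by (rule walk_imp_relpow)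
  moreover have "(ws ! 0 = u \<and> ws ! (n - 1) = v) \<or> (ws ! 0 = v \<and> ws ! (n - 1) = u)"
    using uv by (auto simp: doubleton_eq_iff)
  ultimately show ?thesis using relpow_sym[OF sym] n_def by auto
qed

lemma card_relpow_Image_le:
  fixes R :: "('a \<times> 'a) set"
  assumes "finite R" "\<And>u. card (R `` {u}) \<le> D"
  shows "finite ((R ^^ n) `` {u}) \<and> card ((R ^^ n) `` {u}) \<le> D ^ n"
proof (induction n)
  case (Suc n)
  have eq: "(R ^^ Suc n) `` {u} = (\<Union>w \<in> (R ^^ n) `` {u}. R `` {w})" by auto
  have fin: "finite (R `` {w})" for w using assms(1) by (simp add: finite_Image)
  have "card ((R ^^ Suc n) `` {u}) \<le> (\<Sum>w \<in> (R ^^ n) `` {u}. card (R `` {w}))"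
    unfolding eq by (rule card_UN_le) (use Suc in auto)
  also have "\<dots> \<le> (\<Sum>w \<in> (R ^^ n) `` {u}. D)" by (intro sum_mono assms(2))
  also have "\<dots> \<le> D ^ Suc n" using Suc by simp
  finally show ?case unfolding eq using Suc fin by auto
qed auto

section \<open>Averaging over candidate edges\<close>

lemma card_insert_le_Suc: "card (insert a A) \<le> Suc (card A)"
  by (cases "finite A") (auto simp: card_insert_if)

text \<open>Double counting. Each set of \<open>F\<close> is hit by a share 1/K of the samples and
  \<open>B\<close> takes away at most a share 1/(2K), so a share 1/(2K) of all pairs (sample, set)
  remains outside \<open>B\<close>, and some sample there does as well as the average.\<close>

lemma exists_heavily_hitting:
  fixes hit :: "'w \<Rightarrow> 's \<Rightarrow> bool"
  assumes fin: "finite \<Omega>" "finite F" and "\<Omega> \<noteq> {}" and "K > 0"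
    and hits: "\<And>S. S \<in> F \<Longrightarrow> card \<Omega> \<le> K * card {\<omega> \<in> \<Omega>. hit \<omega> S}"
    and bad: "B \<subseteq> \<Omega>" "2 * K * card B \<le> card \<Omega>"
  shows "\<exists>\<omega> \<in> \<Omega> - B. card F \<le> 2 * K * card {S \<in> F. hit \<omega> S}"
proof (rule ccontr)
  assume "\<not> ?thesis"
  then have small: "2 * K * card {S \<in> F. hit \<omega> S} < card F" if "\<omega> \<in> \<Omega> - B" for \<omega>
    using that by (meson not_le)
  have cpos: "card \<Omega> > 0" using assms by (simp add: card_gt_0_iff)
  have "\<Omega> - B \<noteq> {}"
  proof
    assume "\<Omega> - B = {}"
    then have "B = \<Omega>" using bad by auto
    then have "2 * K \<le> 1" using bad(2) cpos by simp
    then show False using \<open>K > 0\<close> by simp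
  qed
  then have "(\<Sum>\<omega> \<in> \<Omega> - B. 2 * K * card {S \<in> F. hit \<omega> S}) < (\<Sum>\<omega> \<in> \<Omega> - B. card F)"
    using fin small by (intro sum_strict_mono) auto
  also have "\<dots> \<le> card \<Omega> * card F" using fin by (simp add: card_mono)
  finally have less: "(\<Sum>\<omega> \<in> \<Omega> - B. 2 * K * card {S \<in> F. hit \<omega> S}) < card \<Omega> * card F" .
  have "card \<Omega> \<le> 2 * K * card {\<omega> \<in> \<Omega> - B. hit \<omega> S}" if "S \<in> F" for S
  proof -
    have "card {\<omega> \<in> \<Omega>. hit \<omega> S} \<le> card ({\<omega> \<in> \<Omega> - B. hit \<omega> S} \<union> B)"
      using fin bad finite_subset by (intro card_mono) auto
    also have "\<dots> \<le> card {\<omega> \<in> \<Omega> - B. hit \<omega> S} + card B" by (rule card_Un_le)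
    finally have "2 * K * card {\<omega> \<in> \<Omega>. hit \<omega> S}
        \<le> 2 * K * (card {\<omega> \<in> \<Omega> - B. hit \<omega> S} + card B)" by (rule mult_le_mono2)
    then have "2 * (K * card {\<omega> \<in> \<Omega>. hit \<omega> S})
        \<le> 2 * K * card {\<omega> \<in> \<Omega> - B. hit \<omega> S} + 2 * K * card B"
      by (simp only: distrib_left mult.assoc)
    then show ?thesis using hits[OF that] bad(2) by linarith
  qed
  then have "(\<Sum>S \<in> F. card \<Omega>) \<le> (\<Sum>S \<in> F. 2 * K * card {\<omega> \<in> \<Omega> - B. hit \<omega> S})"
    by (rule sum_mono)
  also have "\<dots> = (\<Sum>\<omega> \<in> \<Omega> - B. 2 * K * card {S \<in> F. hit \<omega> S})"
    using sum_multicount_gen[of "\<Omega> - B" F "\<lambda>\<omega> S. hit \<omega> S" "\<lambda>S. card {\<omega> \<in> \<Omega> - B. hit \<omega> S}"] fin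
    by (simp flip: sum_distrib_left)
  finally show False using less by (simp add: mult.commute)
qed

text \<open>(1 - 1/n)^n is at most 1/2, by Bernoulli's inequality for n / (n - 1). With n = 2 K it
  says that 2 K greedy steps halve the surviving family.\<close>

lemma twice_pred_power_le:
  assumes "n > 0"
  shows "2 * (n - 1) ^ n \<le> (n::nat) ^ n"
proof (cases "n = 1")
  case False
  then obtain k where n: "n = Suc k" and k: "k > 0" using assms by (cases n) auto
  have "2 \<le> 1 + real n * (1 / real k)" using k by (simp add: n field_simps)
  also have "\<dots> \<le> (1 + 1 / real k) ^ n"
    by (rule Bernoulli_inequality) (auto intro: order_trans[of _ 0])
  also have "1 + 1 / real k = real n / real k" using k by (simp add: n field_simps)
  finally have "2 \<le> real n ^ n / real k ^ n" by (simp only: power_divide)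
  then have "2 * real k ^ n \<le> real n ^ n" using k by (simp add: pos_le_divide_eq)
  then have "real (2 * k ^ n) \<le> real (n ^ n)" by simp
  then show ?thesis by (simp only: of_nat_le_iff n diff_Suc_1)
qed simp

text \<open>A sample stands for the candidate edge joining \<open>e1 \<omega>\<close> and
  \<open>e2 \<omega>\<close>; \<open>F\<close> is the family of sets that must not stay independent.
  Relations hold both orientations of an edge, so \<open>T\<close> edges amount to at most
  \<open>2 * T\<close> pairs, and \<open>bad\<close> covers every stage of the selection.\<close>

locale edge_sampling =
  fixes \<Omega> :: "'w set" and e1 e2 :: "'w \<Rightarrow> nat" and F :: "nat set set"
    and K D g T :: nat
  assumes fin: "finite \<Omega>" "finite F" and ne: "\<Omega> \<noteq> {}" and K: "K > 0"
    and hits: "\<And>S. S \<in> F \<Longrightarrow> card \<Omega> \<le> K * card {\<omega> \<in> \<Omega>. e1 \<omega> \<in> S \<and> e2 \<omega> \<in> S}"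
    and bad: "\<And>R. finite R \<Longrightarrow> sym R \<Longrightarrow> R \<subseteq> (e1 ` \<Omega> \<union> e2 ` \<Omega>) \<times> (e1 ` \<Omega> \<union> e2 ` \<Omega>) \<Longrightarrow>
      card R \<le> 2 * T \<Longrightarrow> (\<And>u. card (R `` {u}) \<le> D) \<Longrightarrow>
      2 * K * card {\<omega> \<in> \<Omega>. card (R `` {e1 \<omega>}) \<ge> D \<or> card (R `` {e2 \<omega>}) \<ge> D \<or>
                         (\<exists>n<g. (e1 \<omega>, e2 \<omega>) \<in> R ^^ n)} \<le> card \<Omega>"
begin

definition admissible :: "(nat \<times> nat) set \<Rightarrow> bool" where
  "admissible R \<longleftrightarrow> sym R \<and> irrefl R \<and>
     R \<subseteq> (\<lambda>\<omega>. (e1 \<omega>, e2 \<omega>)) ` \<Omega> \<union> (\<lambda>\<omega>. (e2 \<omega>, e1 \<omega>)) ` \<Omega> \<and>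
     (\<forall>u. card (R `` {u}) \<le> D) \<and>
     (\<forall>vs. is_cycle (\<lambda>a b. (a, b) \<in> R) vs \<longrightarrow> length vs \<ge> g)"

abbreviation survivors :: "(nat \<times> nat) set \<Rightarrow> nat set set" where
  "survivors R \<equiv> {S \<in> F. \<forall>(a, b) \<in> R. \<not> (a \<in> S \<and> b \<in> S)}"

lemma admissible_insert:
  assumes R: "admissible R"
    and \<omega>: "\<omega> \<in> \<Omega>" "card (R `` {e1 \<omega>}) < D" "card (R `` {e2 \<omega>}) < D"
    and far: "\<And>n. n < g \<Longrightarrow> (e1 \<omega>, e2 \<omega>) \<notin> R ^^ n" and g: "g > 0"
  shows "admissible (insert (e1 \<omega>, e2 \<omega>) (insert (e2 \<omega>, e1 \<omega>) R))"
proof -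
  let ?u = "e1 \<omega>" and ?v = "e2 \<omega>"
  let ?R = "insert (?u, ?v) (insert (?v, ?u) R)"
  \<comment> \<open>\<open>far\<close> includes the walk of length 0.\<close>
  have ne: "?u \<noteq> ?v" using far[of 0] g by auto
  have s: "sym R" using R by (simp add: admissible_def)
  have "card (?R `` {w}) \<le> D" for w
  proof -
    have "?R `` {w} = (if w = ?u then insert ?v (R `` {w})
        else if w = ?v then insert ?u (R `` {w}) else R `` {w})"
      using ne by auto
    moreover have "card (R `` {w}) \<le> D" using R by (simp add: admissible_def)
    ultimately show ?thesis
      using \<omega> card_insert_le_Suc[of ?v "R `` {w}"] card_insert_le_Suc[of ?u "R `` {w}"]
      by (cases "w = ?u"; cases "w = ?v"; simp)
  qed
  moreover have "length vs \<ge> g" if cyc: "is_cycle (\<lambda>a b. (a, b) \<in> ?R) vs" for vs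
  proof -
    consider "is_cycle (\<lambda>a b. (a, b) \<in> R) vs" | "(?u, ?v) \<in> R ^^ (length vs - 1)"
      using cycle_insert_edge[OF s cyc] by blast
    then show ?thesis
    proof cases
      case 1
      then show ?thesis using R by (simp add: admissible_def)
    next
      case 2
      then show ?thesis using far[of "length vs - 1"] by linarith
    qed
  qed
  moreover have "sym ?R" using s by (auto simp: sym_def)
  moreover have "irrefl ?R" using R ne by (auto simp: admissible_def irrefl_def)
  ultimately show ?thesis using R \<omega>(1) unfolding admissible_def by blast
qed

text \<open>Each step takes a usable sample lying inside at least a share 1/(2K) of the survivors,
  which leaves a factor 1 - 1/(2K); the inequality is this decay with denominators cleared.\<close>

lemma greedy_edges:
  assumes "j \<le> T" and g: "g > 0"
  shows "\<exists>R. admissible R \<and> card R \<le> 2 * j \<and>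
    (2 * K) ^ j * card (survivors R) \<le> (2 * K - 1) ^ j * card F"
  using assms(1)
proof (induction j)
  case 0
  have "\<not> is_cycle (\<lambda>a b. (a, b) \<in> {}) vs" for vs
    by (simp add: is_cycle_def)
  then have "admissible {}" by (auto simp: admissible_def sym_def irrefl_def)
  then show ?case by (intro exI[of _ "{}"]) simp
next
  case (Suc j)
  then obtain R where R: "admissible R" "card R \<le> 2 * j"
    "(2 * K) ^ j * card (survivors R) \<le> (2 * K - 1) ^ j * card F" by auto
  define B where "B = {\<omega> \<in> \<Omega>. card (R `` {e1 \<omega>}) \<ge> D \<or> card (R `` {e2 \<omega>}) \<ge> D \<or>
                         (\<exists>n<g. (e1 \<omega>, e2 \<omega>) \<in> R ^^ n)}"
  have finR: "finite R"
  proof (rule finite_subset)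
    show "R \<subseteq> (\<lambda>\<omega>. (e1 \<omega>, e2 \<omega>)) ` \<Omega> \<union> (\<lambda>\<omega>. (e2 \<omega>, e1 \<omega>)) ` \<Omega>"
      using R(1) unfolding admissible_def by blast
  qed (use fin in simp)
  have "R \<subseteq> (e1 ` \<Omega> \<union> e2 ` \<Omega>) \<times> (e1 ` \<Omega> \<union> e2 ` \<Omega>)"
    using R(1) unfolding admissible_def by blast
  then have "2 * K * card B \<le> card \<Omega>"
    unfolding B_def using R Suc.prems finR by (intro bad) (auto simp: admissible_def)
  moreover have "B \<subseteq> \<Omega>" by (auto simp: B_def)
  ultimately obtain \<omega> where \<omega>: "\<omega> \<in> \<Omega> - B"
    "card (survivors R) \<le> 2 * K * card {S \<in> survivors R. e1 \<omega> \<in> S \<and> e2 \<omega> \<in> S}"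
    using exists_heavily_hitting[of \<Omega> "survivors R" K "\<lambda>\<omega> S. e1 \<omega> \<in> S \<and> e2 \<omega> \<in> S" B]
      fin ne K hits by (simp, blast)
  let ?R = "insert (e1 \<omega>, e2 \<omega>) (insert (e2 \<omega>, e1 \<omega>) R)"
  have adm: "admissible ?R"
    using \<omega>(1) by (intro admissible_insert R(1) g) (auto simp: B_def not_le)
  have cR: "card ?R \<le> 2 * Suc j"
    using R(2) card_insert_le_Suc[of "(e1 \<omega>, e2 \<omega>)" "insert (e2 \<omega>, e1 \<omega>) R"]
      card_insert_le_Suc[of "(e2 \<omega>, e1 \<omega>)" R] unfolding mult_Suc_right by linarith
  have eq: "survivors ?R = survivors R - {S \<in> survivors R. e1 \<omega> \<in> S \<and> e2 \<omega> \<in> S}" by auto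
  have "card (survivors ?R) = card (survivors R) - card {S \<in> survivors R. e1 \<omega> \<in> S \<and> e2 \<omega> \<in> S}"
    unfolding eq using fin by (intro card_Diff_subset) auto
  then have "2 * K * card (survivors ?R)
      = 2 * K * card (survivors R) - 2 * K * card {S \<in> survivors R. e1 \<omega> \<in> S \<and> e2 \<omega> \<in> S}"
    by (simp add: diff_mult_distrib2)
  also have "\<dots> \<le> (2 * K - 1) * card (survivors R)"
    using \<omega>(2) by (simp add: diff_mult_distrib)
  finally have "(2 * K) ^ j * (2 * K * card (survivors ?R)) \<le> (2 * K) ^ j * ((2 * K - 1) * card (survivors R))"
    by (rule mult_le_mono2)
  also have "\<dots> = (2 * K - 1) * ((2 * K) ^ j * card (survivors R))" by (rule mult.left_commute)
  also have "\<dots> \<le> (2 * K - 1) * ((2 * K - 1) ^ j * card F)"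
    using R(3) by (rule mult_le_mono2)
  finally have "(2 * K) ^ Suc j * card (survivors ?R) \<le> (2 * K - 1) ^ Suc j * card F"
    by (simp only: power_Suc mult.assoc mult.left_commute mult.commute)
  then show ?case using adm cR by blast
qed

text \<open>The 2 K N steps are N rounds of 2 K, each halving the survivors, so at most
  \<open>card F / 2 ^ N < 1\<close> are left.\<close>

lemma exists_admissible_no_survivors:
  assumes "T = 2 * K * N" "card F < 2 ^ N" "g > 0"
  shows "\<exists>R. admissible R \<and> survivors R = {}"
proof -
  obtain R where R: "admissible R"
    "(2 * K) ^ T * card (survivors R) \<le> (2 * K - 1) ^ T * card F"
    using greedy_edges[OF le_refl assms(3)] by auto
  have "2 ^ N * (2 * K - 1) ^ T = (2 * (2 * K - 1) ^ (2 * K)) ^ N"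
    by (simp add: assms(1) power_mult power_mult_distrib)
  also have "\<dots> \<le> ((2 * K) ^ (2 * K)) ^ N"
    using K by (intro power_mono twice_pred_power_le) auto
  also have "\<dots> = (2 * K) ^ T" by (simp add: assms(1) power_mult)
  finally have "2 ^ N * (2 * K - 1) ^ T * card (survivors R) \<le> (2 * K) ^ T * card (survivors R)"
    by (rule mult_le_mono1)
  also note R(2)
  finally have "(2 * K - 1) ^ T * (2 ^ N * card (survivors R)) \<le> (2 * K - 1) ^ T * card F"
    by (simp only: mult.assoc mult.commute mult.left_commute)
  then have "2 ^ N * card (survivors R) \<le> card F" using K by simp
  then have "card (survivors R) = 0" using assms(2) by (cases "card (survivors R)") auto
  then show ?thesis using R(1) fin by (intro exI[of _ R]) simp
qed

end

section \<open>Twisted blow-ups\<close>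

text \<open>Pigeonhole in density form: with at most \<open>k\<close> colours some colour class has
  a share 1/k of \<open>V\<close>. The form fits the greedy selection, which destroys dense
  independent sets.\<close>

lemma chromatic_number_gt:
  assumes fin: "finite V" and V: "V \<noteq> {}" and E: "\<And>v. \<not> E v v"
    and indep: "\<And>S. S \<subseteq> V \<Longrightarrow> card V \<le> k * card S \<Longrightarrow> \<exists>u\<in>S. \<exists>v\<in>S. E u v"
  shows "chromatic_number V E > k"
proof (rule ccontr)
  define P where "P n \<longleftrightarrow> (\<exists>c :: nat \<Rightarrow> nat.
      (\<forall>v\<in>V. c v < n) \<and> (\<forall>u\<in>V. \<forall>v\<in>V. E u v \<longrightarrow> c u \<noteq> c v))" for n
  define n where "n = chromatic_number V E"
  assume "\<not> ?thesis"
  then have nk: "n \<le> k" by (simp add: n_def)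
  \<comment> \<open>Colouring every vertex by its own number shows that some number of colours
    works, so that \<open>LEAST\<close> is attained.\<close>
  obtain b where "\<forall>v\<in>V. v < b" using fin finite_nat_set_iff_bounded by blast
  then have "P b" unfolding P_def using E by (intro exI[of _ "\<lambda>v. v"]) metis
  then have "P n" unfolding n_def chromatic_number_def P_def[symmetric] by (rule LeastI)
  then obtain c :: "nat \<Rightarrow> nat" where c: "\<And>v. v \<in> V \<Longrightarrow> c v < n"
    "\<And>u v. u \<in> V \<Longrightarrow> v \<in> V \<Longrightarrow> E u v \<Longrightarrow> c u \<noteq> c v" by (auto simp: P_def)
  have small: "k * card {v \<in> V. c v = j} < card V" for j
    using indep[of "{v \<in> V. c v = j}"] c(2) by fastforce
  have npos: "n > 0" using c(1) V by fastforce
  have "card V = card (\<Union>j<n. {v \<in> V. c v = j})" by (rule arg_cong[of _ _ card]) (use c in auto)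
  also have "\<dots> \<le> (\<Sum>j<n. card {v \<in> V. c v = j})" by (rule card_UN_le) simp
  finally have "k * card V \<le> (\<Sum>j<n. k * card {v \<in> V. c v = j})"
    by (simp flip: sum_distrib_left)
  also have "\<dots> < (\<Sum>j<n. card V)" using small npos by (intro sum_strict_mono) auto
  also have "\<dots> \<le> k * card V" using nk by simp
  finally show False by simp
qed

section \<open>Counting twists with prescribed angles\<close>

lemma card_PiE_restrict_eq:
  fixes L :: nat
  assumes "finite M" "B \<subseteq> M" "\<tau> \<in> PiE B (\<lambda>_. {..<L})"
  shows "card {t \<in> PiE M (\<lambda>_. {..<L}). restrict t B = \<tau>} = L ^ (card M - card B)"
proof -
  have "{t \<in> PiE M (\<lambda>_. {..<L}). restrict t B = \<tau>} = PiE M (\<lambda>i. if i \<in> B then {\<tau> i} else {..<L})"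
  proof (intro equalityI subsetI)
    fix t assume t: "t \<in> {t \<in> PiE M (\<lambda>_. {..<L}). restrict t B = \<tau>}"
    then have "t i = \<tau> i" if "i \<in> B" for i using that by auto
    then show "t \<in> PiE M (\<lambda>i. if i \<in> B then {\<tau> i} else {..<L})" using t by (auto simp: PiE_iff)
  next
    fix t assume t: "t \<in> PiE M (\<lambda>i. if i \<in> B then {\<tau> i} else {..<L})"
    have ti: "t i = \<tau> i" if "i \<in> B" for i using t that assms(2) by (force simp: PiE_iff)
    have "restrict t B = \<tau>"
    proof
      fix i show "restrict t B i = \<tau> i"
        using ti assms(3) by (cases "i \<in> B") (auto simp: PiE_iff extensional_def)
    qed
    moreover have "t i < L" if "i \<in> M" for i
      using t that assms(3) by (cases "i \<in> B") (force simp: PiE_iff)+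
    ultimately show "t \<in> {t \<in> PiE M (\<lambda>_. {..<L}). restrict t B = \<tau>}"
      using t by (auto simp: PiE_iff)
  qed
  then have "card {t \<in> PiE M (\<lambda>_. {..<L}). restrict t B = \<tau>} = (\<Prod>i\<in>M. if i \<in> B then 1 else L)"
    using assms(1) by (simp add: card_PiE if_distrib cong: if_cong)
  also have "\<dots> = (\<Prod>i\<in>M - B. L)"
    using assms(1) by (intro prod.mono_neutral_cong_right) auto
  also have "\<dots> = L ^ (card M - card B)"
    using assms by (simp add: card_Diff_subset finite_subset)
  finally show ?thesis .
qed

text \<open>If any function meets both prescriptions, they glue to one prescription on
  \<open>B \<union> C\<close>.\<close>

lemma card_PiE_restrict2_le:
  fixes L :: nat
  assumes "finite M" "B \<subseteq> M" "C \<subseteq> M"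
  shows "card {t \<in> PiE M (\<lambda>_. {..<L}). restrict t B = \<tau> \<and> restrict t C = \<sigma>} \<le> L ^ (card M - card (B \<union> C))"
    (is "card ?Q \<le> _")
proof (cases "?Q = {}")
  case False
  then obtain t0 where t0: "t0 \<in> ?Q" by blast
  define \<rho> where "\<rho> = restrict t0 (B \<union> C)"
  have "restrict t (B \<union> C) = \<rho>" if "t \<in> ?Q" for t
  proof
    fix i show "restrict t (B \<union> C) i = \<rho> i"
      using that t0 restrict_apply'[of i B t] restrict_apply'[of i B t0]
        restrict_apply'[of i C t] restrict_apply'[of i C t0]
      unfolding \<rho>_def by (cases "i \<in> B"; cases "i \<in> C") auto
  qed
  then have "?Q \<subseteq> {t \<in> PiE M (\<lambda>_. {..<L}). restrict t (B \<union> C) = \<rho>}" by auto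
  then have "card ?Q \<le> card {t \<in> PiE M (\<lambda>_. {..<L}). restrict t (B \<union> C) = \<rho>}"
    using assms(1) by (intro card_mono finite_Collect_conjI disjI1) (auto simp: finite_PiE)
  also have "\<dots> = L ^ (card M - card (B \<union> C))"
    using assms t0 by (intro card_PiE_restrict_eq) (auto simp: \<rho>_def PiE_iff)
  finally show ?thesis .
next
  case True
  then show ?thesis by (simp only: card.empty)
qed

text \<open>The base graph. All supports have the same size \<open>q\<close>,
  \<open>\<alpha>\<close> bounds the independent sets, and \<open>k * \<alpha> < card X\<close> is
  the gap that the blow-up inherits. Taken at \<open>x = y\<close>, \<open>supp_ne\<close> also
  excludes loops.\<close>

locale supported_graph =
  fixes X :: "'a set" and supp :: "'a \<Rightarrow> nat set" and orth :: "'a \<Rightarrow> 'a \<Rightarrow> bool"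
    and m q \<alpha> k :: nat
  assumes finX: "finite X"
    and supp: "\<And>x. x \<in> X \<Longrightarrow> supp x \<subseteq> {..<m} \<and> card (supp x) = q"
    and supp_ne: "\<And>x y. x \<in> X \<Longrightarrow> y \<in> X \<Longrightarrow> orth x y \<Longrightarrow> supp x \<noteq> supp y"
    and indep: "\<And>I. I \<subseteq> X \<Longrightarrow> (\<And>x y. x \<in> I \<Longrightarrow> y \<in> I \<Longrightarrow> \<not> orth x y) \<Longrightarrow> card I \<le> \<alpha>"
    and k: "k > 0" "k * \<alpha> < card X"
begin

definition twists :: "nat \<Rightarrow> (nat \<Rightarrow> nat) set" where
  "twists L = PiE {..<m} (\<lambda>_. {..<L})"

text \<open>A vertex carries only the angles on the support of its vector. A twist \<open>t\<close>
  thus embeds a copy of the base graph by \<open>vert t\<close>, and copies meet exactly where their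
  twists agree on a support.\<close>

definition verts :: "nat \<Rightarrow> ('a \<times> (nat \<Rightarrow> nat)) set" where
  "verts L = (SIGMA x:X. PiE (supp x) (\<lambda>_. {..<L}))"

definition orth_pairs :: "('a \<times> 'a) set" where
  "orth_pairs = {(x, y). x \<in> X \<and> y \<in> X \<and> orth x y}"

abbreviation vert :: "(nat \<Rightarrow> nat) \<Rightarrow> 'a \<Rightarrow> 'a \<times> (nat \<Rightarrow> nat)" where
  "vert t x \<equiv> (x, restrict t (supp x))"

definition samples :: "nat \<Rightarrow> ((nat \<Rightarrow> nat) \<times> 'a \<times> 'a) set" where
  "samples L = twists L \<times> orth_pairs"

lemma finite_twists: "finite (twists L)"
  by (simp add: twists_def finite_PiE)

lemma card_twists: "card (twists L) = L ^ m"
  by (simp add: twists_def card_PiE)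

lemma finite_supp: "x \<in> X \<Longrightarrow> finite (supp x)"
  using supp finite_subset by blast

lemma finite_verts: "finite (verts L)"
  unfolding verts_def using finX finite_supp by (intro finite_SigmaI finite_PiE) auto

lemma card_verts: "card (verts L) = card X * L ^ q"
proof -
  have "card (verts L) = (\<Sum>x\<in>X. card (PiE (supp x) (\<lambda>_. {..<L})))"
    unfolding verts_def using finX finite_supp by (intro card_SigmaI) (auto intro: finite_PiE)
  also have "\<dots> = (\<Sum>x\<in>X. L ^ q)"
    using supp finite_supp by (intro sum.cong) (auto simp: card_PiE)
  finally show ?thesis by simp
qed

lemma orth_pairs_subset: "orth_pairs \<subseteq> X \<times> X"
  by (auto simp: orth_pairs_def)

lemma finite_orth_pairs: "finite orth_pairs"
  using orth_pairs_subset finX finite_subset by blast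

lemma card_orth_pairs_le: "card orth_pairs \<le> card X ^ 2"
  using card_mono[OF _ orth_pairs_subset] finX by (simp add: card_cartesian_product power2_eq_square)

lemma orth_pairs_nonempty: "orth_pairs \<noteq> {}"
proof
  assume "orth_pairs = {}"
  then have "card X \<le> \<alpha>" by (intro indep) (auto simp: orth_pairs_def)
  moreover have "\<alpha> \<le> k * \<alpha>" using k by simp
  ultimately show False using k by linarith
qed

lemma finite_samples: "finite (samples L)"
  by (simp add: samples_def finite_twists finite_orth_pairs)

lemma card_samples: "card (samples L) = L ^ m * card orth_pairs"
  by (simp add: samples_def card_cartesian_product card_twists)

lemma card_samples_ge: "L ^ m \<le> card (samples L)"
  using orth_pairs_nonempty finite_orth_pairs by (simp add: card_samples Suc_le_eq card_gt_0_iff)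

lemma vert_in_verts: "x \<in> X \<Longrightarrow> t \<in> twists L \<Longrightarrow> vert t x \<in> verts L"
  using supp by (fastforce simp: verts_def twists_def PiE_iff)

lemma card_twists_through:
  assumes "v \<in> verts L"
  shows "card {t \<in> twists L. vert t (fst v) = v} = L ^ (m - q)"
proof -
  obtain x \<tau> where v: "v = (x, \<tau>)" "x \<in> X" "\<tau> \<in> PiE (supp x) (\<lambda>_. {..<L})"
    using assms by (auto simp: verts_def)
  then show ?thesis
    using card_PiE_restrict_eq[of "{..<m}" "supp x" \<tau> L] supp[of x] by (simp add: twists_def)
qed

text \<open>An orthogonal pair gives two different \<open>q\<close>-subsets of
  \<open>{..<m}\<close>. The inequality keeps the exponent \<open>m - q - 1\<close> from being
  truncated.\<close>

lemma q_less_m: "q < m"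
proof -
  obtain x y where "(x, y) \<in> orth_pairs" using orth_pairs_nonempty by auto
  then have x: "x \<in> X" and y: "y \<in> X" and ne: "supp x \<noteq> supp y"
    using supp_ne by (auto simp: orth_pairs_def)
  have "supp x \<noteq> {..<m} \<or> supp y \<noteq> {..<m}" using ne by auto
  then obtain z where "z \<in> X" "supp z \<subset> {..<m}" using x y supp by auto
  then show ?thesis using psubset_card_mono[of "{..<m}" "supp z"] supp[of z] by auto
qed

lemma card_samples_fst_le:
  assumes v: "v \<in> verts L"
  shows "card {\<omega> \<in> samples L. vert (fst \<omega>) (fst (snd \<omega>)) = v} \<le> L ^ (m - q) * card X"
proof -
  have "{\<omega> \<in> samples L. vert (fst \<omega>) (fst (snd \<omega>)) = v} \<subseteq> {t \<in> twists L. vert t (fst v) = v} \<times> ({fst v} \<times> X)"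
    by (auto simp: samples_def orth_pairs_def)
  then have "card {\<omega> \<in> samples L. vert (fst \<omega>) (fst (snd \<omega>)) = v}
      \<le> card ({t \<in> twists L. vert t (fst v) = v} \<times> ({fst v} \<times> X))"
    using finX finite_twists by (intro card_mono) auto
  then show ?thesis using card_twists_through[OF v] by (simp add: card_cartesian_product)
qed

lemma card_samples_snd_le:
  assumes v: "v \<in> verts L"
  shows "card {\<omega> \<in> samples L. vert (fst \<omega>) (snd (snd \<omega>)) = v} \<le> L ^ (m - q) * card X"
proof -
  have "{\<omega> \<in> samples L. vert (fst \<omega>) (snd (snd \<omega>)) = v} \<subseteq> {t \<in> twists L. vert t (fst v) = v} \<times> (X \<times> {fst v})"
    by (auto simp: samples_def orth_pairs_def)
  then have "card {\<omega> \<in> samples L. vert (fst \<omega>) (snd (snd \<omega>)) = v}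
      \<le> card ({t \<in> twists L. vert t (fst v) = v} \<times> (X \<times> {fst v}))"
    using finX finite_twists by (intro card_mono) auto
  then show ?thesis using card_twists_through[OF v] by (simp add: card_cartesian_product)
qed

text \<open>Different supports of equal size cover at least \<open>q + 1\<close> coordinates, so two
  endpoints fix one angle more than a single vertex does. This gain of a factor \<open>L\<close>
  controls the pairs at small distance.\<close>

lemma card_samples_both_le:
  assumes L: "L > 0"
  shows "card {\<omega> \<in> samples L. vert (fst \<omega>) (fst (snd \<omega>)) = v \<and> vert (fst \<omega>) (snd (snd \<omega>)) = w}
    \<le> L ^ (m - q - 1)" (is "card ?Q \<le> _")
proof (cases "(fst v, fst w) \<in> orth_pairs")
  case False
  then have "?Q = {}" by (auto simp: samples_def)
  then show ?thesis by (simp only: card.empty)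
next
  case True
  let ?B = "supp (fst v)" and ?C = "supp (fst w)"
  have vw: "fst v \<in> X" "fst w \<in> X" "?B \<noteq> ?C" using True supp_ne by (auto simp: orth_pairs_def)
  have "?B \<subset> ?B \<union> ?C"
  proof (rule ccontr)
    assume "\<not> ?B \<subset> ?B \<union> ?C"
    then have "?C \<subseteq> ?B" by auto
    then have "?C = ?B" using supp[OF vw(1)] supp[OF vw(2)] finite_supp[OF vw(1)] by (metis card_subset_eq)
    then show False using vw(3) by simp
  qed
  then have "q < card (?B \<union> ?C)"
    using psubset_card_mono[of "?B \<union> ?C" ?B] finite_supp[OF vw(1)] finite_supp[OF vw(2)] supp[OF vw(1)]
    by simp
  then have exp: "m - card (?B \<union> ?C) \<le> m - q - 1" by linarith
  have "?Q \<subseteq> {t \<in> twists L. restrict t ?B = snd v \<and> restrict t ?C = snd w} \<times> {(fst v, fst w)}"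
    by (auto simp: samples_def)
  then have "card ?Q \<le> card ({t \<in> twists L. restrict t ?B = snd v \<and> restrict t ?C = snd w} \<times> {(fst v, fst w)})"
    using finite_twists by (intro card_mono) auto
  also have "\<dots> = card {t \<in> twists L. restrict t ?B = snd v \<and> restrict t ?C = snd w}"
    by (simp add: card_cartesian_product)
  also have "\<dots> \<le> L ^ (m - card (?B \<union> ?C))"
    using card_PiE_restrict2_le[of "{..<m}" ?B ?C L "snd v" "snd w"] supp[OF vw(1)] supp[OF vw(2)]
    by (simp add: twists_def)
  also have "\<dots> \<le> L ^ (m - q - 1)" using exp L by (intro power_increasing) auto
  finally show ?thesis .
qed

text \<open>A vertex set \<open>S\<close> of density at least \<open>1 / k\<close> meets the random copy of the base graph given by a
  uniform twist in more than \<open>\<alpha>\<close> points on average, so a fixed fraction of all copies has an edge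
  inside \<open>S\<close>.\<close>

lemma card_samples_inside_ge:
  assumes S: "S \<subseteq> verts L" and dense: "card (verts L) \<le> k * card S"
  shows "card (samples L) \<le> k * card X ^ 3 *
    card {\<omega> \<in> samples L. vert (fst \<omega>) (fst (snd \<omega>)) \<in> S \<and> vert (fst \<omega>) (snd (snd \<omega>)) \<in> S}"
    (is "_ \<le> _ * card ?H")
proof -
  have finS: "finite S" using S finite_verts finite_subset by blast
  define Y where "Y t = {x \<in> X. vert t x \<in> S}" for t
  define B where "B = {t \<in> twists L. \<alpha> < card (Y t)}"
  have finB: "finite B" using finite_twists by (simp add: B_def)
  have cY: "card (Y t) = card {v \<in> S. vert t (fst v) = v}" for t
  proof (rule bij_betw_same_card)
    show "bij_betw (vert t) (Y t) {v \<in> S. vert t (fst v) = v}"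
      unfolding bij_betw_def Y_def using S by (force simp: inj_on_def verts_def image_iff)
  qed
  have "(\<Sum>t\<in>twists L. card (Y t)) = (\<Sum>t\<in>twists L. card {v \<in> S. vert t (fst v) = v})"
    by (simp add: cY)
  also have "\<dots> = (\<Sum>v\<in>S. card {t \<in> twists L. vert t (fst v) = v})"
    using sum_multicount_gen[of "twists L" S "\<lambda>t v. vert t (fst v) = v"
        "\<lambda>v. card {t \<in> twists L. vert t (fst v) = v}"] finS finite_twists by simp
  also have "\<dots> = (\<Sum>v\<in>S. L ^ (m - q))" using S by (intro sum.cong card_twists_through) auto
  finally have total: "(\<Sum>t\<in>twists L. card (Y t)) = card S * L ^ (m - q)" by simp
  have "card (Y t) \<le> \<alpha> + (if t \<in> B then card X else 0)" if "t \<in> twists L" for t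
    using card_mono[of X "Y t"] finX that by (auto simp: B_def Y_def not_less)
  then have "(\<Sum>t\<in>twists L. card (Y t)) \<le> (\<Sum>t\<in>twists L. \<alpha> + (if t \<in> B then card X else 0))"
    by (rule sum_mono)
  also have "\<dots> = \<alpha> * L ^ m + card B * card X"
  proof -
    have "(\<Sum>t\<in>twists L. if t \<in> B then card X else 0) = (\<Sum>t\<in>B. card X)"
      using finite_twists by (intro sum.mono_neutral_cong_right) (auto simp: B_def)
    then show ?thesis by (simp add: sum.distrib card_twists mult.commute)
  qed
  finally have upper: "card S * L ^ (m - q) \<le> \<alpha> * L ^ m + card B * card X" unfolding total .
  have "L ^ m = L ^ q * L ^ (m - q)" using q_less_m by (simp flip: power_add)
  then have "card X * L ^ m = card (verts L) * L ^ (m - q)" by (simp add: card_verts)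
  also have "\<dots> \<le> k * (card S * L ^ (m - q))" using dense by (metis mult.assoc mult_le_mono1)
  also have "\<dots> \<le> k * (\<alpha> * L ^ m + card B * card X)" using upper by (rule mult_le_mono2)
  finally have 1: "card X * L ^ m \<le> k * \<alpha> * L ^ m + k * card B * card X" by (simp add: algebra_simps)
  \<comment> \<open>Since \<open>card X\<close> exceeds \<open>k * \<alpha>\<close> by at least 1,
    the contribution of \<open>\<alpha>\<close> points per copy falls short by \<open>L ^ m\<close>,
    which the copies in \<open>B\<close> have to supply.\<close>
  have "(k * \<alpha> + 1) * L ^ m \<le> card X * L ^ m" using k by (intro mult_le_mono1) auto
  with 1 have LB: "L ^ m \<le> k * card B * card X" by (simp add: algebra_simps)
  have "\<forall>t. \<exists>p. t \<in> B \<longrightarrow> (t, p) \<in> ?H"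
  proof
    fix t show "\<exists>p. t \<in> B \<longrightarrow> (t, p) \<in> ?H"
    proof (cases "t \<in> B")
      case True
      have "\<exists>x y. x \<in> Y t \<and> y \<in> Y t \<and> orth x y"
        using indep[of "Y t"] True by (force simp: B_def Y_def)
      then obtain x y where "x \<in> Y t" "y \<in> Y t" "orth x y" by auto
      then show ?thesis using True
        by (intro exI[of _ "(x, y)"]) (auto simp: Y_def B_def samples_def orth_pairs_def)
    qed simp
  qed
  then obtain p where p: "\<forall>t. t \<in> B \<longrightarrow> (t, p t) \<in> ?H" by (rule choice[THEN exE])
  \<comment> \<open>One edge inside \<open>S\<close> per copy in \<open>B\<close> is enough; the
    trivial bound on the number of orthogonal pairs then costs two more factors
    \<open>card X\<close>.\<close>
  have "card B \<le> card ?H"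
    using finite_samples p by (intro card_inj_on_le[of "\<lambda>t. (t, p t)"] inj_onI image_subsetI) auto
  then have "k * card B * card X \<le> k * card ?H * card X" by (intro mult_le_mono) auto
  with LB have "L ^ m \<le> k * card ?H * card X" by linarith
  then have "L ^ m * card orth_pairs \<le> (k * card ?H * card X) * card X ^ 2"
    using card_orth_pairs_le by (rule mult_le_mono)
  also have "\<dots> = k * card X ^ 3 * card ?H"
    by (simp only: power2_eq_square power3_eq_cube ac_simps)
  finally show ?thesis unfolding card_samples .
qed

end

lemma card_high_degree_le:
  fixes R :: "('a \<times> 'a) set"
  assumes "finite R" and "finite H" and "\<And>v. v \<in> H \<Longrightarrow> D \<le> card (R `` {v})"
  shows "card H * D \<le> card R"
proof -
  have "card H * D \<le> (\<Sum>v\<in>H. card (R `` {v}))"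
    using sum_mono[of H "\<lambda>_. D" "\<lambda>v. card (R `` {v})"] assms(3) by simp
  also have "\<dots> = card (SIGMA v:H. R `` {v})"
    using assms(1,2) by (intro card_SigmaI[symmetric]) (auto intro: finite_Image)
  also have "\<dots> \<le> card R" using assms(1) by (intro card_mono) auto
  finally show ?thesis .
qed

context supported_graph
begin

text \<open>\<open>B1\<close>: at most \<open>4 * K * card (verts L) / D\<close> vertices are
  saturated, and \<open>D\<close> is chosen to make the samples at them a share 1/(4K).
  \<open>B2\<close>: a vertex reaches at most \<open>g * D ^ g\<close> vertices in fewer than
  \<open>g\<close> steps, each pair lies in at most \<open>L ^ (m - q - 1)\<close> samples, and
  \<open>L\<close> is chosen to give 1/(4K) again. The choices are not circular: the number of edges
  is linear in the number of vertices, so \<open>D\<close> does not involve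
  \<open>L\<close>.\<close>

lemma card_bad_samples_le:
  fixes h :: "'a \<times> (nat \<Rightarrow> nat) \<Rightarrow> nat" and L D g K :: nat
  defines "e1 \<equiv> \<lambda>\<omega> :: (nat \<Rightarrow> nat) \<times> 'a \<times> 'a. h (vert (fst \<omega>) (fst (snd \<omega>)))"
    and "e2 \<equiv> \<lambda>\<omega> :: (nat \<Rightarrow> nat) \<times> 'a \<times> 'a. h (vert (fst \<omega>) (snd (snd \<omega>)))"
  assumes h: "inj_on h (verts L)" and K: "K > 0"
    and D: "D = 32 * K ^ 2 * card X ^ 2" and L: "L = 4 * K * card X * (g * D ^ g)" and g: "g > 0"
    and R: "finite R" "card R \<le> 4 * K * card (verts L)" "\<And>u. card (R `` {u}) \<le> D"
  shows "2 * K * card {\<omega> \<in> samples L. D \<le> card (R `` {e1 \<omega>}) \<or> D \<le> card (R `` {e2 \<omega>}) \<or>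
      (\<exists>n<g. (e1 \<omega>, e2 \<omega>) \<in> R ^^ n)} \<le> card (samples L)"
proof -
  have Xpos: "card X > 0" using k by linarith
  have Dpos: "D > 0" using K Xpos by (simp add: D)
  have Lpos: "L > 0" using K Xpos g Dpos by (simp add: L)
  define H where "H = {v \<in> verts L. D \<le> card (R `` {h v})}"
  define P where "P v w = {\<omega> \<in> samples L. vert (fst \<omega>) (fst (snd \<omega>)) = v \<and> vert (fst \<omega>) (snd (snd \<omega>)) = w}" for v w
  define Near where "Near v = (\<Union>n<g. {w \<in> verts L. h w \<in> (R ^^ n) `` {h v}})" for v
  define B1 where "B1 = (\<Union>v\<in>H. {\<omega> \<in> samples L. vert (fst \<omega>) (fst (snd \<omega>)) = v}
      \<union> {\<omega> \<in> samples L. vert (fst \<omega>) (snd (snd \<omega>)) = v})"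
  define B2 where "B2 = (\<Union>v\<in>verts L. \<Union>w\<in>Near v. P v w)"
  have in1: "vert (fst \<omega>) (fst (snd \<omega>)) \<in> verts L" and in2: "vert (fst \<omega>) (snd (snd \<omega>)) \<in> verts L"
    if "\<omega> \<in> samples L" for \<omega>
    using that orth_pairs_subset by (auto simp: samples_def intro!: vert_in_verts)
  have finH: "finite H" using finite_verts by (simp add: H_def)
  have finNear: "finite (Near v)" for v
    unfolding Near_def using finite_verts by (intro finite_UN_I) auto
  have finP: "finite (P v w)" for v w using finite_samples by (simp add: P_def)

  have "card H * D \<le> card R"
  proof -
    have inj: "inj_on h H" using h by (rule inj_on_subset) (auto simp: H_def)
    have "card (h ` H) * D \<le> card R"
      using R(1) finH by (intro card_high_degree_le) (auto simp: H_def)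
    then show ?thesis by (simp add: card_image[OF inj])
  qed
  then have HD: "card H * D \<le> 4 * K * (card X * L ^ q)" using R(2) by (simp add: card_verts)
  have "card B1 \<le> (\<Sum>v\<in>H. card ({\<omega> \<in> samples L. vert (fst \<omega>) (fst (snd \<omega>)) = v}
      \<union> {\<omega> \<in> samples L. vert (fst \<omega>) (snd (snd \<omega>)) = v}))"
    unfolding B1_def by (rule card_UN_le[OF finH])
  also have "\<dots> \<le> (\<Sum>v\<in>H. 2 * (L ^ (m - q) * card X))"
  proof (rule sum_mono)
    fix v assume "v \<in> H"
    then have v: "v \<in> verts L" by (simp add: H_def)
    show "card ({\<omega> \<in> samples L. vert (fst \<omega>) (fst (snd \<omega>)) = v}
      \<union> {\<omega> \<in> samples L. vert (fst \<omega>) (snd (snd \<omega>)) = v}) \<le> 2 * (L ^ (m - q) * card X)"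
      unfolding mult_2
      by (rule order_trans[OF card_Un_le add_mono[OF card_samples_fst_le[OF v] card_samples_snd_le[OF v]]])
  qed
  finally have B1: "card B1 \<le> card H * (2 * (L ^ (m - q) * card X))" by simp
  have LL: "L ^ q * L ^ (m - q) = L ^ m" using q_less_m by (simp flip: power_add)
  have "D * card B1 \<le> D * (card H * (2 * (L ^ (m - q) * card X)))" using B1 by (rule mult_le_mono2)
  also have "\<dots> = (card H * D) * (2 * (L ^ (m - q) * card X))" by (simp add: ac_simps)
  also have "\<dots> \<le> (4 * K * (card X * L ^ q)) * (2 * (L ^ (m - q) * card X))"
    using HD by (rule mult_le_mono1)
  also have "\<dots> = (8 * K * card X ^ 2) * (L ^ q * L ^ (m - q))"
    by (simp add: power2_eq_square ac_simps)
  also have "\<dots> \<le> (8 * K * card X ^ 2) * card (samples L)"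
    unfolding LL by (intro mult_le_mono2 card_samples_ge)
  finally have "(8 * K * card X ^ 2) * (4 * K * card B1) \<le> (8 * K * card X ^ 2) * card (samples L)"
    by (simp add: D power2_eq_square ac_simps)
  then have B1': "4 * K * card B1 \<le> card (samples L)" using K Xpos by simp

  have cNear: "card (Near v) \<le> g * D ^ g" for v
  proof -
    have "card (Near v) \<le> (\<Sum>n<g. card {w \<in> verts L. h w \<in> (R ^^ n) `` {h v}})"
      unfolding Near_def by (rule card_UN_le) simp
    also have "\<dots> \<le> (\<Sum>n<g. D ^ g)"
    proof (rule sum_mono)
      fix n assume n: "n \<in> {..<g}"
      have "card {w \<in> verts L. h w \<in> (R ^^ n) `` {h v}} \<le> card ((R ^^ n) `` {h v})"
        using card_relpow_Image_le[OF R(1,3)] h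
        by (intro card_inj_on_le[of h]) (auto simp: inj_on_def)
      also have "\<dots> \<le> D ^ n" using card_relpow_Image_le[OF R(1,3)] by blast
      also have "\<dots> \<le> D ^ g" using n Dpos by (intro power_increasing) auto
      finally show "card {w \<in> verts L. h w \<in> (R ^^ n) `` {h v}} \<le> D ^ g" .
    qed
    finally show ?thesis by simp
  qed
  have "card B2 \<le> (\<Sum>v\<in>verts L. card (\<Union>w\<in>Near v. P v w))"
    unfolding B2_def by (rule card_UN_le[OF finite_verts])
  also have "\<dots> \<le> (\<Sum>v\<in>verts L. (g * D ^ g) * L ^ (m - q - 1))"
  proof (rule sum_mono)
    fix v
    have "card (\<Union>w\<in>Near v. P v w) \<le> (\<Sum>w\<in>Near v. card (P v w))" by (rule card_UN_le[OF finNear])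
    also have "\<dots> \<le> (\<Sum>w\<in>Near v. L ^ (m - q - 1))"
      unfolding P_def by (intro sum_mono card_samples_both_le Lpos)
    also have "\<dots> = card (Near v) * L ^ (m - q - 1)" by simp
    also have "\<dots> \<le> (g * D ^ g) * L ^ (m - q - 1)" by (intro mult_le_mono1 cNear)
    finally show "card (\<Union>w\<in>Near v. P v w) \<le> (g * D ^ g) * L ^ (m - q - 1)" .
  qed
  also have "\<dots> = card X * L ^ q * ((g * D ^ g) * L ^ (m - q - 1))" by (simp add: card_verts)
  finally have "4 * K * card B2 \<le> 4 * K * (card X * L ^ q * ((g * D ^ g) * L ^ (m - q - 1)))"
    by (rule mult_le_mono2)
  also have "\<dots> = (4 * K * card X * (g * D ^ g)) * (L ^ q * L ^ (m - q - 1))" by (simp only: ac_simps)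
  also have "\<dots> = L * (L ^ q * L ^ (m - q - 1))" by (simp only: L[symmetric])
  also have "\<dots> = L ^ Suc (q + (m - q - 1))" by (simp only: power_add power_Suc)
  also have "Suc (q + (m - q - 1)) = m" using q_less_m by linarith
  finally have B2': "4 * K * card B2 \<le> card (samples L)" using card_samples_ge[of L] by linarith

  have "{\<omega> \<in> samples L. D \<le> card (R `` {e1 \<omega>}) \<or> D \<le> card (R `` {e2 \<omega>}) \<or>
      (\<exists>n<g. (e1 \<omega>, e2 \<omega>) \<in> R ^^ n)} \<subseteq> B1 \<union> B2" (is "?Bad \<subseteq> _")
  proof
    fix \<omega> assume \<omega>: "\<omega> \<in> ?Bad"
    then have s: "\<omega> \<in> samples L" by simp
    let ?v = "vert (fst \<omega>) (fst (snd \<omega>))" and ?w = "vert (fst \<omega>) (snd (snd \<omega>))"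
    consider "?v \<in> H" | "?w \<in> H" | n where "n < g" "(h ?v, h ?w) \<in> R ^^ n"
      using \<omega> in1[OF s] in2[OF s] unfolding e1_def e2_def H_def by blast
    then show "\<omega> \<in> B1 \<union> B2"
    proof cases
      case 3
      then have "?w \<in> Near ?v" using in2[OF s] unfolding Near_def by blast
      moreover have "\<omega> \<in> P ?v ?w" using s unfolding P_def by simp
      ultimately show ?thesis using in1[OF s] unfolding B2_def by blast
    qed (use s in \<open>unfold B1_def, blast+\<close>)
  qed
  moreover have "finite (B1 \<union> B2)"
    unfolding B1_def B2_def using finH finite_samples finite_verts finNear finP
    by (intro finite_UnI finite_UN_I) auto
  ultimately have "card ?Bad \<le> card (B1 \<union> B2)" by (intro card_mono)
  also have "\<dots> \<le> card B1 + card B2" by (rule card_Un_le)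
  finally have "2 * K * card ?Bad \<le> 2 * K * (card B1 + card B2)" by (rule mult_le_mono2)
  then show ?thesis using B1' B2' unfolding distrib_left by linarith
qed

theorem exists_sparse_blowup:
  assumes g: "g > 0"
  shows "\<exists>L h E. inj_on h (verts L) \<and> simple_graph (h ` verts L) E \<and>
    girth_ge (h ` verts L) E g \<and> k < chromatic_number (h ` verts L) E \<and>
    (\<forall>u v. E u v \<longrightarrow> (\<exists>t\<in>twists L. \<exists>x\<in>X. \<exists>y\<in>X. (orth x y \<or> orth y x) \<and>
        u = h (vert t x) \<and> v = h (vert t y)))"
proof -
  \<comment> \<open>1/K is the share of samples inside a dense set, from
    \<open>card_samples_inside_ge\<close>.\<close>
  define K where "K = k * card X ^ 3"
  define D where "D = 32 * K ^ 2 * card X ^ 2"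
  define L where "L = 4 * K * card X * (g * D ^ g)"
  define N where "N = card (verts L)"
  obtain h where "bij_betw h (verts L) {0..<N}"
    unfolding N_def using ex_bij_betw_finite_nat[OF finite_verts] by blast
  then have h: "inj_on h (verts L)" by (auto simp: bij_betw_def)
  define e1 where "e1 = (\<lambda>\<omega> :: (nat \<Rightarrow> nat) \<times> 'a \<times> 'a. h (vert (fst \<omega>) (fst (snd \<omega>))))"
  define e2 where "e2 = (\<lambda>\<omega> :: (nat \<Rightarrow> nat) \<times> 'a \<times> 'a. h (vert (fst \<omega>) (snd (snd \<omega>))))"
  let ?V = "h ` verts L"
  define F where "F = {S. S \<subseteq> ?V \<and> card ?V \<le> k * card S}"
  have cV: "card ?V = N" using h by (simp add: N_def card_image)
  have Xpos: "card X > 0" using k by linarith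
  have Kpos: "K > 0" using k Xpos by (simp add: K_def)
  have Lpos: "L > 0" using Kpos Xpos g by (simp add: L_def D_def)
  have Npos: "N > 0" using Xpos Lpos by (simp add: N_def card_verts)
  have finV: "finite ?V" using finite_verts by blast
  have in1: "e1 \<omega> \<in> ?V" and in2: "e2 \<omega> \<in> ?V" if "\<omega> \<in> samples L" for \<omega>
    using that orth_pairs_subset by (auto simp: samples_def e1_def e2_def intro!: imageI vert_in_verts)
  interpret edge_sampling "samples L" e1 e2 F K D g "2 * K * N"
  proof
    show "finite (samples L)" by (rule finite_samples)
    show "finite F" using finV by (auto simp: F_def)
    have "card (samples L) > 0" using card_samples_ge[of L] Lpos by (metis less_le_trans zero_less_power)
    then show "samples L \<noteq> {}" by auto
    show "K > 0" by (rule Kpos)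
  next
    fix S assume "S \<in> F"
    then have S: "S \<subseteq> ?V" "N \<le> k * card S" by (auto simp: F_def cV)
    define S' where "S' = {v \<in> verts L. h v \<in> S}"
    have eq: "S = h ` S'" using S(1) by (auto simp: S'_def)
    have "inj_on h S'" using h by (rule inj_on_subset) (auto simp: S'_def)
    then have "card S = card S'" unfolding eq by (rule card_image)
    then have "card (samples L) \<le> K * card {\<omega> \<in> samples L. vert (fst \<omega>) (fst (snd \<omega>)) \<in> S' \<and> vert (fst \<omega>) (snd (snd \<omega>)) \<in> S'}"
      unfolding K_def using S(2) by (intro card_samples_inside_ge) (auto simp: S'_def N_def)
    also have "\<dots> \<le> K * card {\<omega> \<in> samples L. e1 \<omega> \<in> S \<and> e2 \<omega> \<in> S}"
      using finite_samples unfolding S'_def e1_def e2_def by (intro mult_le_mono2 card_mono) auto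
    finally show "card (samples L) \<le> K * card {\<omega> \<in> samples L. e1 \<omega> \<in> S \<and> e2 \<omega> \<in> S}" .
  next
    fix R :: "(nat \<times> nat) set"
    assume R: "finite R" "card R \<le> 2 * (2 * K * N)" "\<And>u. card (R `` {u}) \<le> D"
    show "2 * K * card {\<omega> \<in> samples L. D \<le> card (R `` {e1 \<omega>}) \<or> D \<le> card (R `` {e2 \<omega>}) \<or>
      (\<exists>n<g. (e1 \<omega>, e2 \<omega>) \<in> R ^^ n)} \<le> card (samples L)"
      unfolding e1_def e2_def
      by (rule card_bad_samples_le[OF h Kpos D_def L_def g R(1) _ R(3)]) (use R(2) in \<open>simp add: N_def\<close>)
  qed
  \<comment> \<open>The empty set is not dense, which makes \<open>card F < 2 ^ N\<close>
    strict.\<close>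
  have "{} \<notin> F" using Npos cV by (simp add: F_def)
  then have "F \<subset> Pow ?V" unfolding F_def by blast
  then have "card F < card (Pow ?V)" using finV by (intro psubset_card_mono) auto
  then have "card F < 2 ^ N" using finV by (simp add: card_Pow cV)
  then obtain R where R: "admissible R" "survivors R = {}"
    using exists_admissible_no_survivors[OF refl _ g] by blast
  define E where "E = (\<lambda>u v. (u, v) \<in> R)"
  have edge: "\<exists>\<omega>\<in>samples L. (u, v) = (e1 \<omega>, e2 \<omega>) \<or> (u, v) = (e2 \<omega>, e1 \<omega>)" if "E u v" for u v
    using R(1) that unfolding admissible_def E_def by blast
  have irr: "\<not> E v v" for v using R(1) by (auto simp: admissible_def irrefl_def E_def)
  have "simple_graph ?V E"
    unfolding simple_graph_def
  proof (intro allI impI conjI)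
    fix u v assume uv: "E u v"
    show "u \<in> ?V" "v \<in> ?V" using edge[OF uv] in1 in2 by auto
    show "u \<noteq> v" using uv irr by auto
    show "E v u" using uv R(1) by (auto simp: admissible_def E_def sym_def)
  qed
  moreover have "girth_ge ?V E g"
    using R(1) unfolding girth_ge_def admissible_def E_def by blast
  moreover have "k < chromatic_number ?V E"
  proof (rule chromatic_number_gt[OF finV _ irr])
    show "?V \<noteq> {}" using Npos cV by auto
    fix S assume "S \<subseteq> ?V" "card ?V \<le> k * card S"
    then have "S \<in> F" by (simp add: F_def)
    then show "\<exists>u\<in>S. \<exists>v\<in>S. E u v" using R(2) unfolding E_def by blast
  qed
  moreover have "\<exists>t\<in>twists L. \<exists>x\<in>X. \<exists>y\<in>X. (orth x y \<or> orth y x) \<and>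
        u = h (vert t x) \<and> v = h (vert t y)" if uv: "E u v" for u v
  proof -
    obtain t x y where w: "(t, x, y) \<in> samples L"
      "(u, v) = (h (vert t x), h (vert t y)) \<or> (u, v) = (h (vert t y), h (vert t x))"
      using edge[OF uv] by (auto simp: e1_def e2_def)
    then have "t \<in> twists L" "x \<in> X" "y \<in> X" "orth x y" by (auto simp: samples_def orth_pairs_def)
    with w(2) show ?thesis by blast
  qed
  ultimately show ?thesis using h by blast
qed

end

section \<open>Frankl--Wilson bound for Gaussian unit vectors\<close>

text \<open>There are more unknowns than homogeneous equations; the elimination is fraction-free and
  so stays in the integers.\<close>

lemma exists_int_dependency:
  fixes a :: "'c \<Rightarrow> 'x \<Rightarrow> int"
  assumes "finite C" "finite I" "card C < card I"
  shows "\<exists>\<xi>. (\<exists>x\<in>I. \<xi> x \<noteq> 0) \<and> (\<forall>c\<in>C. (\<Sum>x\<in>I. \<xi> x * a c x) = 0)"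
  using assms
proof (induction C arbitrary: I a rule: finite_induct)
  case empty
  then have "I \<noteq> {}" by auto
  then show ?case by (intro exI[of _ "\<lambda>_. 1"]) auto
next
  case (insert c C)
  show ?case
  proof (cases "\<forall>x\<in>I. a c x = 0")
    case True
    obtain \<xi> where "\<exists>x\<in>I. \<xi> x \<noteq> 0" "\<forall>d\<in>C. (\<Sum>x\<in>I. \<xi> x * a d x) = 0"
      using insert.IH[of I a] insert.prems insert.hyps by auto
    moreover have "(\<Sum>x\<in>I. \<xi> x * a c x) = 0" using True by simp
    ultimately show ?thesis by auto
  next
    case False
    then obtain z where z: "z \<in> I" "a c z \<noteq> 0" by auto
    define J where "J = I - {z}"
    have finJ: "finite J" and I: "I = insert z J" and zJ: "z \<notin> J"
      using z insert.prems by (auto simp: J_def)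
    have "card C < card J" using insert.prems insert.hyps z by (simp add: J_def)
    then obtain \<mu> where \<mu>: "\<exists>x\<in>J. \<mu> x \<noteq> 0"
      "\<And>d. d \<in> C \<Longrightarrow> (\<Sum>x\<in>J. \<mu> x * (a c z * a d x - a c x * a d z)) = 0"
      using insert.IH[OF finJ, of "\<lambda>d x. a c z * a d x - a c x * a d z"] by auto
    \<comment> \<open>Back substitution: the equation of \<open>c\<close> is solved for the unknown
      at \<open>z\<close>, everything being scaled by \<open>a c z\<close>.\<close>
    define \<xi> where "\<xi> x = (if x = z then - (\<Sum>x\<in>J. \<mu> x * a c x) else a c z * \<mu> x)" for x
    have "(\<Sum>x\<in>I. \<xi> x * a d x) = (\<Sum>x\<in>J. \<mu> x * (a c z * a d x - a c x * a d z))" for d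
    proof -
      have "(\<Sum>x\<in>I. \<xi> x * a d x) = \<xi> z * a d z + (\<Sum>x\<in>J. \<xi> x * a d x)"
        unfolding I using finJ zJ by simp
      also have "(\<Sum>x\<in>J. \<xi> x * a d x) = (\<Sum>x\<in>J. a c z * \<mu> x * a d x)"
        using zJ by (intro sum.cong) (auto simp: \<xi>_def)
      finally have "(\<Sum>x\<in>I. \<xi> x * a d x) = (\<Sum>x\<in>J. a c z * \<mu> x * a d x) - (\<Sum>x\<in>J. \<mu> x * a c x * a d z)"
        by (simp add: \<xi>_def sum_distrib_right)
      also have "\<dots> = (\<Sum>x\<in>J. \<mu> x * (a c z * a d x - a c x * a d z))"
        unfolding sum_subtractf[symmetric] by (intro sum.cong) (auto simp: algebra_simps)
      finally show ?thesis .
    qed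
    moreover have "(\<Sum>x\<in>J. \<mu> x * (a c z * a c x - a c x * a c z)) = 0"
      by (simp add: mult.commute)
    moreover have "\<exists>x\<in>I. \<xi> x \<noteq> 0"
    proof -
      obtain x where "x \<in> J" "\<mu> x \<noteq> 0" using \<mu>(1) by auto
      then show ?thesis using z zJ I by (intro bexI[of _ x]) (auto simp: \<xi>_def)
    qed
    ultimately show ?thesis using \<mu>(2) by (intro exI[of _ \<xi>]) auto
  qed
qed

text \<open>Factors \<open>p\<close> are divided out while all coefficients allow it; the sum of
  absolute values drops each time. The resulting dependency is nontrivial modulo
  \<open>p\<close>.\<close>

lemma exists_primitive_multiple:
  fixes \<xi> :: "'x \<Rightarrow> int" and p :: int
  assumes "finite I" "\<exists>x\<in>I. \<xi> x \<noteq> 0" "prime p"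
  shows "\<exists>\<mu> j. j \<noteq> 0 \<and> (\<forall>x\<in>I. \<xi> x = j * \<mu> x) \<and> (\<exists>x\<in>I. \<not> p dvd \<mu> x)"
  using assms(2)
proof (induction "\<Sum>x\<in>I. nat \<bar>\<xi> x\<bar>" arbitrary: \<xi> rule: less_induct)
  case less
  have p1: "p > 1" using assms(3) by (simp add: prime_gt_1_int)
  show ?case
  proof (cases "\<exists>x\<in>I. \<not> p dvd \<xi> x")
    case True
    then show ?thesis by (intro exI[of _ \<xi>] exI[of _ 1]) auto
  next
    case False
    define \<nu> where "\<nu> x = \<xi> x div p" for x
    have \<nu>: "\<xi> x = p * \<nu> x" if "x \<in> I" for x using False that by (simp add: \<nu>_def)
    have le: "nat \<bar>\<nu> x\<bar> \<le> nat \<bar>\<xi> x\<bar>" if "x \<in> I" for x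
      using p1 \<nu>[OF that] by (intro nat_mono) (simp add: abs_mult mult_le_cancel_right1)
    obtain z where z: "z \<in> I" "\<xi> z \<noteq> 0" using less.prems by auto
    then have "\<nu> z \<noteq> 0" using \<nu>[of z] by auto
    then have "\<bar>\<nu> z\<bar> < p * \<bar>\<nu> z\<bar>" using p1 by simp
    then have "nat \<bar>\<nu> z\<bar> < nat \<bar>\<xi> z\<bar>" using \<nu>[OF z(1)] p1 by (simp add: abs_mult)
    then have "(\<Sum>x\<in>I. nat \<bar>\<nu> x\<bar>) < (\<Sum>x\<in>I. nat \<bar>\<xi> x\<bar>)"
      using le z(1) assms(1) by (intro sum_strict_mono_ex1) auto
    then obtain \<mu> j where "j \<noteq> 0" "\<forall>x\<in>I. \<nu> x = j * \<mu> x" "\<exists>x\<in>I. \<not> p dvd \<mu> x"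
      using less.hyps \<open>\<nu> z \<noteq> 0\<close> z(1) by blast
    then show ?thesis using \<nu> p1 by (intro exI[of _ \<mu>] exI[of _ "p * j"]) auto
  qed
qed

text \<open>The binomial coefficient with an arbitrary, possibly negative, upper argument; the
  division is exact because a product of \<open>n\<close> consecutive integers is divisible by
  \<open>fact n\<close>.\<close>

definition int_binomial :: "int \<Rightarrow> nat \<Rightarrow> int" where
  "int_binomial a n = (\<Prod>i=0..<n. a - int i) div fact n"

lemma int_binomial_mult_fact: "fact n * int_binomial a n = (\<Prod>i=0..<n. a - int i)"
  unfolding int_binomial_def falling_fact_pochhammer' using fact_dvd_pochhammer by simp

lemma int_binomial_self: "int_binomial (int n) n = 1"
proof -
  have "(\<Prod>i=0..<n. int n - int i) = fact n"
  proof (induction n)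
    case (Suc n)
    have "(\<Prod>i=0..<Suc n. int (Suc n) - int i) = int (Suc n) * (\<Prod>i=0..<n. int n - int i)"
      by (subst prod.atLeast0_lessThan_Suc_shift) simp
    then show ?case using Suc by simp
  qed simp
  then show ?thesis by (simp add: int_binomial_def)
qed

text \<open>From q C(a, q) = a C(a - 1, q - 1): if \<open>p\<close> did not divide the second
  binomial, that binomial would be coprime to the power \<open>q\<close> of \<open>p\<close>, and
  \<open>q\<close> would divide \<open>a\<close>.\<close>

lemma prime_dvd_int_binomial_pred:
  fixes p a :: int
  assumes p: "prime p" and q: "int q = p ^ k" "q > 0" and a: "\<not> int q dvd a"
  shows "p dvd int_binomial (a - 1) (q - 1)"
proof (rule ccontr)
  let ?b = "int_binomial (a - 1) (q - 1)"
  assume "\<not> p dvd ?b"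
  then have "coprime p ?b" using p by (simp add: prime_imp_coprime)
  then have cop: "coprime (int q) ?b" using q by simp
  have Suc: "q = Suc (q - 1)" using q(2) by simp
  have "fact q * int_binomial a q = (\<Prod>i = 0..<q. a - int i)" by (rule int_binomial_mult_fact)
  also have "\<dots> = a * (\<Prod>i = 0..<q - 1. a - 1 - int i)"
    by (subst Suc, subst prod.atLeast0_lessThan_Suc_shift) (simp add: algebra_simps)
  also have "\<dots> = a * (fact (q - 1) * ?b)" by (simp only: int_binomial_mult_fact)
  finally have "fact (q - 1) * (int q * int_binomial a q) = fact (q - 1) * (a * ?b)"
    using fact_reduce[OF q(2), where 'a = int] by (simp add: ac_simps)
  then have "int q * int_binomial a q = a * ?b" by simp
  then have "int q dvd a * ?b" by (metis dvd_triv_left)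
  then show False using a cop by (simp add: coprime_dvd_mult_left_iff)
qed

text \<open>The units \<open>\<plusminus>1, \<plusminus>\<i>\<close> and \<open>0\<close> as pairs (real part, imaginary part).\<close>

definition gunits :: "(int \<times> int) set" where
  "gunits = {(0,0), (1,0), (-1,0), (0,1), (0,-1)}"

definition gvecs :: "nat \<Rightarrow> (nat \<Rightarrow> int \<times> int) set" where
  "gvecs m = PiE {..<m} (\<lambda>_. gunits)"

definition ip :: "nat \<Rightarrow> (nat \<Rightarrow> int \<times> int) \<Rightarrow> (nat \<Rightarrow> int \<times> int) \<Rightarrow> int" where
  "ip m x y = (\<Sum>i<m. fst (x i) * fst (y i) + snd (x i) * snd (y i))"

text \<open>On \<^term>\<open>gunits\<close> the coordinates satisfy \<open>a^3 = a\<close>, \<open>b^3 = b\<close>, \<open>a b = 0\<close>, so \<open>1, a, a^2, b, b^2\<close>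
  span all polynomial functions of one coordinate pair.\<close>

definition mono1 :: "nat \<Rightarrow> int \<times> int \<Rightarrow> int" where
  "mono1 j v = (if j = 0 then 1 else if j = 1 then fst v else if j = 2 then fst v ^ 2
     else if j = 3 then snd v else snd v ^ 2)"

definition deg1 :: "nat \<Rightarrow> nat" where
  "deg1 j = (if j = 0 then 0 else if j = 1 \<or> j = 3 then 1 else 2)"

section \<open>Polynomial functions of bounded degree on Gaussian unit vectors\<close>

definition exponents :: "nat \<Rightarrow> nat \<Rightarrow> (nat \<Rightarrow> nat) set" where
  "exponents m n = {c \<in> PiE {..<m} (\<lambda>_. {..<5}). (\<Sum>i<m. deg1 (c i)) \<le> n}"

definition monom_fun :: "nat \<Rightarrow> (nat \<Rightarrow> nat) \<Rightarrow> (nat \<Rightarrow> int \<times> int) \<Rightarrow> int" where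
  "monom_fun m c y = (\<Prod>i<m. mono1 (c i) (y i))"

text \<open>Equality is asked only on \<open>gvecs m\<close>, where the relations between the
  coordinates reduce every monomial to the five codes per entry.\<close>

definition spanned :: "nat \<Rightarrow> nat \<Rightarrow> ((nat \<Rightarrow> int \<times> int) \<Rightarrow> int) \<Rightarrow> bool" where
  "spanned m n f \<longleftrightarrow> (\<exists>a. \<forall>y\<in>gvecs m. f y = (\<Sum>c\<in>exponents m n. a c * monom_fun m c y))"

lemma finite_exponents: "finite (exponents m n)"
proof -
  have "finite (PiE {..<m} (\<lambda>_. {..<5::nat}))" by (rule finite_PiE) auto
  then show ?thesis unfolding exponents_def by (rule rev_finite_subset) auto
qed

lemma spanned_add:
  assumes "spanned m n f" "spanned m n f'"
  shows "spanned m n (\<lambda>y. f y + f' y)"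
proof -
  obtain a b where "\<forall>y\<in>gvecs m. f y = (\<Sum>c\<in>exponents m n. a c * monom_fun m c y)"
    "\<forall>y\<in>gvecs m. f' y = (\<Sum>c\<in>exponents m n. b c * monom_fun m c y)"
    using assms by (auto simp: spanned_def)
  then show ?thesis unfolding spanned_def
    by (intro exI[of _ "\<lambda>c. a c + b c"]) (simp add: distrib_right sum.distrib)
qed

lemma spanned_scale:
  assumes "spanned m n f"
  shows "spanned m n (\<lambda>y. r * f y)"
proof -
  obtain a where "\<forall>y\<in>gvecs m. f y = (\<Sum>c\<in>exponents m n. a c * monom_fun m c y)"
    using assms by (auto simp: spanned_def)
  then show ?thesis unfolding spanned_def
    by (intro exI[of _ "\<lambda>c. r * a c"]) (simp add: mult.assoc sum_distrib_left)
qed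

lemma spanned_zero: "spanned m n (\<lambda>y. 0)"
  unfolding spanned_def by (intro exI[of _ "\<lambda>_. 0"]) simp

lemma spanned_sum:
  assumes "finite J" "\<And>j. j \<in> J \<Longrightarrow> spanned m n (f j)"
  shows "spanned m n (\<lambda>y. \<Sum>j\<in>J. f j y)"
  using assms by (induction J rule: finite_induct) (auto intro: spanned_zero spanned_add)

lemma spanned_cong:
  assumes "spanned m n f" "\<And>y. y \<in> gvecs m \<Longrightarrow> f y = f' y"
  shows "spanned m n f'"
  using assms unfolding spanned_def by auto

lemma spanned_monom:
  assumes "c \<in> exponents m n"
  shows "spanned m n (monom_fun m c)"
  unfolding spanned_def
proof (intro exI ballI)
  fix y
  show "monom_fun m c y = (\<Sum>d\<in>exponents m n. (if d = c then 1 else 0) * monom_fun m d y)"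
    using assms finite_exponents by (simp add: if_distrib[of "\<lambda>t. t * _"] sum.delta cong: if_cong)
qed

lemma spanned_mono:
  assumes "spanned m n f" "n \<le> n'"
  shows "spanned m n' f"
proof -
  obtain a where a: "\<forall>y\<in>gvecs m. f y = (\<Sum>c\<in>exponents m n. a c * monom_fun m c y)"
    using assms by (auto simp: spanned_def)
  have "spanned m n' (\<lambda>y. \<Sum>c\<in>exponents m n. a c * monom_fun m c y)"
    using assms(2) by (intro spanned_sum spanned_scale spanned_monom finite_exponents) (auto simp: exponents_def)
  then show ?thesis by (rule spanned_cong) (use a in auto)
qed

lemma monom_fun_upd:
  assumes "i < m"
  shows "monom_fun m (c(i := j)) y = mono1 j (y i) * (\<Prod>l\<in>{..<m} - {i}. mono1 (c l) (y l))"
  unfolding monom_fun_def using assms by (subst prod.remove[of _ i]) auto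

lemma exponents_upd:
  assumes "c \<in> exponents m n" "i < m" "j < 5" "deg1 j \<le> Suc (deg1 (c i))"
  shows "c(i := j) \<in> exponents m (Suc n)"
proof -
  have "(\<Sum>l<m. deg1 ((c(i := j)) l)) = deg1 j + (\<Sum>l\<in>{..<m} - {i}. deg1 (c l))"
    using assms(2) by (subst sum.remove[of _ i]) auto
  also have "\<dots> \<le> Suc (deg1 (c i) + (\<Sum>l\<in>{..<m} - {i}. deg1 (c l)))" using assms(4) by simp
  also have "\<dots> = Suc (\<Sum>l<m. deg1 (c l))" using assms(2) by (subst (2) sum.remove[of _ i]) auto
  finally have "(\<Sum>l<m. deg1 ((c(i := j)) l)) \<le> Suc n" using assms(1) by (simp add: exponents_def)
  moreover have "c(i := j) \<in> PiE {..<m} (\<lambda>_. {..<5})"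
    using assms by (auto simp: exponents_def PiE_iff extensional_def)
  ultimately show ?thesis by (simp add: exponents_def)
qed

lemma monom_fun_split:
  assumes "i < m"
  shows "monom_fun m c y = mono1 (c i) (y i) * (\<Prod>l\<in>{..<m} - {i}. mono1 (c l) (y l))"
  using monom_fun_upd[OF assms, of c "c i"] by simp

text \<open>The degree grows by at most one: a coordinate times its own square drops back to the
  coordinate, and the product with a power of the other part of the same entry vanishes.\<close>

lemma spanned_mult_coord:
  assumes i: "i < m" and f: "spanned m n f" and s: "s = 1 \<or> s = 3"
  shows "spanned m (Suc n) (\<lambda>y. mono1 s (y i) * f y)"
proof -
  obtain a where a: "\<forall>y\<in>gvecs m. f y = (\<Sum>c\<in>exponents m n. a c * monom_fun m c y)"
    using f by (auto simp: spanned_def)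
  have "spanned m (Suc n) (\<lambda>y. mono1 s (y i) * monom_fun m c y)" if c: "c \<in> exponents m n" for c
  proof -
    have ci: "c i < 5" using c i by (auto simp: exponents_def PiE_iff)
    \<comment> \<open>\<open>Suc s\<close> codes the square of the part coded by \<open>s\<close>;
      the factor \<open>r\<close> is 0 for the vanishing products.\<close>
    define j where "j = (if c i = 0 then s else if c i = s then Suc s else s)"
    define r :: int where "r = (if c i = 0 \<or> c i = s \<or> c i = Suc s then 1 else 0)"
    have yi: "y i \<in> gunits" if "y \<in> gvecs m" for y using that i by (auto simp: gvecs_def PiE_iff)
    have "mono1 s v * mono1 (c i) v = r * mono1 j v" if "v \<in> gunits" for v
    proof -
      have "c i = 0 \<or> c i = 1 \<or> c i = 2 \<or> c i = 3 \<or> c i = 4" using ci by linarith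
      then show ?thesis using s that
        by (elim disjE) (auto simp: r_def j_def mono1_def gunits_def)
    qed
    then have eq: "mono1 s (y i) * monom_fun m c y = r * monom_fun m (c(i := j)) y" if "y \<in> gvecs m" for y
      unfolding monom_fun_upd[OF i] monom_fun_split[OF i, of c] using yi[OF that]
      by (simp only: mult.assoc[symmetric])
    have "c(i := j) \<in> exponents m (Suc n)"
      using c i s by (intro exponents_upd) (auto simp: j_def deg1_def)
    then have "spanned m (Suc n) (\<lambda>y. r * monom_fun m (c(i := j)) y)"
      by (intro spanned_scale spanned_monom)
    then show ?thesis by (rule spanned_cong) (simp add: eq)
  qed
  then have "spanned m (Suc n) (\<lambda>y. \<Sum>c\<in>exponents m n. a c * (mono1 s (y i) * monom_fun m c y))"
    by (intro spanned_sum spanned_scale finite_exponents)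
  then show ?thesis by (rule spanned_cong) (use a in \<open>auto simp: sum_distrib_left ac_simps\<close>)
qed

lemma spanned_mult_ip:
  assumes "spanned m n f"
  shows "spanned m (Suc n) (\<lambda>y. (ip m x y - r) * f y)"
proof -
  have "spanned m (Suc n) (\<lambda>y. fst (x i) * (mono1 1 (y i) * f y) + snd (x i) * (mono1 3 (y i) * f y))"
    if "i \<in> {..<m}" for i
    by (rule spanned_add; rule spanned_scale; rule spanned_mult_coord[OF _ assms]) (use that in auto)
  then have "spanned m (Suc n) (\<lambda>y. \<Sum>i<m. fst (x i) * (mono1 1 (y i) * f y) + snd (x i) * (mono1 3 (y i) * f y))"
    by (intro spanned_sum) auto
  moreover have "spanned m (Suc n) (\<lambda>y. (-r) * f y)"
    by (rule spanned_scale, rule spanned_mono[OF assms]) simp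
  ultimately have "spanned m (Suc n) (\<lambda>y. (\<Sum>i<m. fst (x i) * (mono1 1 (y i) * f y) + snd (x i) * (mono1 3 (y i) * f y)) + (-r) * f y)"
    by (rule spanned_add)
  then show ?thesis
    by (rule spanned_cong) (simp add: ip_def mono1_def sum_distrib_right sum_distrib_left algebra_simps sum.distrib)
qed

lemma spanned_one: "spanned m n (\<lambda>y. 1)"
proof -
  have "(\<lambda>i\<in>{..<m}. 0) \<in> exponents m n" by (auto simp: exponents_def deg1_def)
  from spanned_monom[OF this] show ?thesis
    by (rule spanned_cong) (simp add: monom_fun_def mono1_def)
qed

text \<open>For n = q - 1 this product is (q - 1)! times C(<x, y> - 1, q - 1).\<close>

lemma spanned_prod_ip: "spanned m n (\<lambda>y. \<Prod>i=0..<n. ip m x y - 1 - int i)"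
proof (induction n)
  case 0
  then show ?case using spanned_one by simp
next
  case (Suc n)
  from spanned_mult_ip[OF this, of x "1 + int n"] show ?case
    by (rule spanned_cong) (simp add: algebra_simps)
qed

text \<open>Modulo \<open>p\<close> the matrix of C(<x, y> - 1, q - 1) over \<open>I\<close> is the
  identity, while its rows come from polynomials of degree below \<open>q\<close>. These have
  integer coefficients only after multiplication by (q - 1)!, which \<open>p\<close> may divide. So
  a dependency is taken over the integers, made primitive, and reduced modulo \<open>p\<close> only
  after the factorial has been cancelled.\<close>

theorem frankl_wilson_bound:
  fixes p :: int
  assumes p: "prime p" and q: "int q = p ^ k" "q > 0"
    and I: "I \<subseteq> gvecs m" and diag: "\<And>x. x \<in> I \<Longrightarrow> ip m x x = int q"
    and off: "\<And>x y. x \<in> I \<Longrightarrow> y \<in> I \<Longrightarrow> x \<noteq> y \<Longrightarrow> \<not> int q dvd ip m x y"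
  shows "card I \<le> card (exponents m (q - 1))"
proof (rule ccontr)
  assume "\<not> ?thesis"
  then have less: "card (exponents m (q - 1)) < card I" by simp
  then have finI: "finite I" by (metis card.infinite not_less0)
  let ?b = "\<lambda>x y. int_binomial (ip m x y - 1) (q - 1)"
  have "\<forall>x. \<exists>a. \<forall>y\<in>gvecs m. (\<Prod>i=0..<q - 1. ip m x y - 1 - int i)
      = (\<Sum>c\<in>exponents m (q - 1). a c * monom_fun m c y)"
    using spanned_prod_ip by (simp add: spanned_def)
  then obtain a where a: "\<And>x y. y \<in> gvecs m \<Longrightarrow> (\<Prod>i=0..<q - 1. ip m x y - 1 - int i)
      = (\<Sum>c\<in>exponents m (q - 1). a x c * monom_fun m c y)" by metis
  obtain \<xi> where \<xi>: "\<exists>x\<in>I. \<xi> x \<noteq> 0" "\<forall>c\<in>exponents m (q - 1). (\<Sum>x\<in>I. \<xi> x * a x c) = 0"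
    using exists_int_dependency[OF finite_exponents finI less, of "\<lambda>c x. a x c"] by auto
  obtain \<mu> j where \<mu>: "j \<noteq> 0" "\<forall>x\<in>I. \<xi> x = j * \<mu> x" "\<exists>x\<in>I. \<not> p dvd \<mu> x"
    using exists_primitive_multiple[OF finI \<xi>(1) p] by auto
  then obtain z where z: "z \<in> I" "\<not> p dvd \<mu> z" by auto
  have "j * fact (q - 1) * (\<Sum>x\<in>I. \<mu> x * ?b x z) = (\<Sum>x\<in>I. \<xi> x * (fact (q - 1) * ?b x z))"
    using \<mu>(2) by (simp add: sum_distrib_left ac_simps)
  also have "\<dots> = (\<Sum>x\<in>I. \<Sum>c\<in>exponents m (q - 1). \<xi> x * (a x c * monom_fun m c z))"
    using a[of z] z(1) I by (auto simp: int_binomial_mult_fact sum_distrib_left)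
  also have "\<dots> = (\<Sum>c\<in>exponents m (q - 1). \<Sum>x\<in>I. \<xi> x * (a x c * monom_fun m c z))"
    by (rule sum.swap)
  also have "\<dots> = (\<Sum>c\<in>exponents m (q - 1). (\<Sum>x\<in>I. \<xi> x * a x c) * monom_fun m c z)"
    by (simp add: sum_distrib_right mult.assoc)
  also have "\<dots> = 0" using \<xi>(2) by simp
  finally have "(\<Sum>x\<in>I. \<mu> x * ?b x z) = 0" using \<mu>(1) by simp
  moreover have "(\<Sum>x\<in>I. \<mu> x * ?b x z) = \<mu> z * ?b z z + (\<Sum>x\<in>I - {z}. \<mu> x * ?b x z)"
    using finI z(1) by (rule sum.remove)
  moreover have "?b z z = 1"
  proof -
    have "ip m z z - 1 = int (q - 1)" using diag[OF z(1)] q(2) by simp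
    then show ?thesis by (simp only: int_binomial_self)
  qed
  moreover have "p dvd (\<Sum>x\<in>I - {z}. \<mu> x * ?b x z)"
    using off z(1) by (intro dvd_sum dvd_mult prime_dvd_int_binomial_pred[OF p q]) auto
  ultimately have "\<mu> z + (\<Sum>x\<in>I - {z}. \<mu> x * ?b x z) = 0" "p dvd (\<Sum>x\<in>I - {z}. \<mu> x * ?b x z)"
    by simp_all
  then have "p dvd \<mu> z" by (simp only: add_eq_0_iff2 dvd_minus_iff)
  then show False using z(2) by simp
qed

text \<open>Exponential weighting by \<open>z\<close> to the degree, where the five codes of an
  entry sum to the base on the right; \<open>z\<close> is chosen later according to
  \<open>q / m\<close>.\<close>

lemma card_exponents_le:
  fixes z :: real
  assumes z: "0 < z" "z \<le> 1"
  shows "real (card (exponents m n)) * z ^ n \<le> (1 + 2 * z + 2 * z\<^sup>2) ^ m"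
proof -
  let ?P = "PiE {..<m} (\<lambda>_. {..<5::nat})"
  have finP: "finite ?P" by (rule finite_PiE) auto
  have "real (card (exponents m n)) * z ^ n = (\<Sum>c\<in>exponents m n. z ^ n)" by simp
  also have "\<dots> \<le> (\<Sum>c\<in>exponents m n. \<Prod>i<m. z ^ deg1 (c i))"
  proof (rule sum_mono)
    fix c assume "c \<in> exponents m n"
    then have "(\<Sum>i<m. deg1 (c i)) \<le> n" by (simp add: exponents_def)
    then show "z ^ n \<le> (\<Prod>i<m. z ^ deg1 (c i))"
      using z by (simp add: power_sum[symmetric] power_decreasing)
  qed
  also have "\<dots> \<le> (\<Sum>c\<in>?P. \<Prod>i<m. z ^ deg1 (c i))"
  proof (rule sum_mono2[OF finP])
    show "exponents m n \<subseteq> ?P" unfolding exponents_def by (rule Collect_restrict)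
    show "0 \<le> (\<Prod>i<m. z ^ deg1 (c i))" for c using z(1) by (intro prod_nonneg zero_le_power) simp
  qed
  also have "\<dots> = (\<Prod>i<m. \<Sum>j<5. z ^ deg1 j)" by (rule prod_sum_PiE[symmetric]) auto
  also have "(\<Sum>j<5. z ^ deg1 j) = 1 + 2 * z + 2 * z\<^sup>2"
    by (simp add: numeral_eq_Suc deg1_def)
  finally show ?thesis by simp
qed

section \<open>Parity classes\<close>

definition gsupp :: "nat \<Rightarrow> (nat \<Rightarrow> int \<times> int) \<Rightarrow> nat set" where
  "gsupp m x = {i. i < m \<and> x i \<noteq> (0,0)}"

definition layer :: "nat \<Rightarrow> nat \<Rightarrow> (nat \<Rightarrow> int \<times> int) set" where
  "layer m q = {x \<in> gvecs m. card (gsupp m x) = q}"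

lemma gvecs_coord: "x \<in> gvecs m \<Longrightarrow> i < m \<Longrightarrow> x i \<in> gunits"
  by (auto simp: gvecs_def PiE_iff)

lemma gvecs_eqI:
  assumes "x \<in> gvecs m" "y \<in> gvecs m" "\<And>i. i < m \<Longrightarrow> x i = y i"
  shows "x = y"
  using assms unfolding gvecs_def by (intro PiE_ext[of x "{..<m}" "\<lambda>_. gunits" y]) auto

lemma finite_gvecs: "finite (gvecs m)"
  unfolding gvecs_def by (rule finite_PiE) (auto simp: gunits_def)

lemma finite_layer: "finite (layer m q)"
  using finite_gvecs by (simp add: layer_def)

lemma card_layer: "card (layer m q) = (m choose q) * 4 ^ q"
proof -
  define Q where "Q S = PiE {..<m} (\<lambda>i. if i \<in> S then gunits - {(0,0)} else {(0,0)})" for S :: "nat set"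
  define \<S> where "\<S> = {S. S \<subseteq> {..<m} \<and> card S = q}"
  have fin\<S>: "finite \<S>" unfolding \<S>_def by (rule finite_subset[of _ "Pow {..<m}"]) auto
  have suppQ: "gsupp m x = S" if "x \<in> Q S" "S \<subseteq> {..<m}" for x S
    using that by (fastforce simp: Q_def gsupp_def PiE_iff split: if_splits)
  have "layer m q = (\<Union>S\<in>\<S>. Q S)"
  proof (intro equalityI subsetI)
    fix x assume x: "x \<in> layer m q"
    then have "x \<in> Q (gsupp m x)"
      by (auto simp: layer_def gvecs_def Q_def gsupp_def PiE_iff)
    moreover have "gsupp m x \<in> \<S>" using x by (auto simp: \<S>_def layer_def gsupp_def)
    ultimately show "x \<in> (\<Union>S\<in>\<S>. Q S)" by blast
  next
    fix x assume "x \<in> (\<Union>S\<in>\<S>. Q S)"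
    then obtain S where S: "S \<subseteq> {..<m}" "card S = q" "x \<in> Q S" by (auto simp: \<S>_def)
    have "x i \<in> gunits" if "i < m" for i
      using S(3) that by (cases "i \<in> S") (force simp: Q_def PiE_iff gunits_def)+
    then have "x \<in> gvecs m" using S(3) by (auto simp: gvecs_def Q_def PiE_iff)
    then show "x \<in> layer m q" using suppQ[OF S(3,1)] S(2) by (simp add: layer_def)
  qed
  also have "card \<dots> = (\<Sum>S\<in>\<S>. card (Q S))"
  proof (rule card_UN_disjoint[OF fin\<S>])
    show "\<forall>S\<in>\<S>. finite (Q S)" unfolding Q_def by (auto intro!: finite_PiE simp: gunits_def)
    show "\<forall>S\<in>\<S>. \<forall>S'\<in>\<S>. S \<noteq> S' \<longrightarrow> Q S \<inter> Q S' = {}"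
      using suppQ unfolding \<S>_def by blast
  qed
  also have "\<dots> = (\<Sum>S\<in>\<S>. 4 ^ q)"
  proof (rule sum.cong[OF refl])
    fix S assume S: "S \<in> \<S>"
    have "card (Q S) = (\<Prod>i<m. card (if i \<in> S then gunits - {(0,0)} else {(0,0)}))"
      unfolding Q_def by (rule card_PiE) simp
    also have "\<dots> = (\<Prod>i<m. if i \<in> S then 4 else 1)"
      by (rule prod.cong) (auto simp: gunits_def)
    also have "\<dots> = (\<Prod>i\<in>S. 4)"
      using S by (intro prod.mono_neutral_cong_right) (auto simp: \<S>_def)
    also have "\<dots> = 4 ^ q" using S by (simp add: \<S>_def)
    finally show "card (Q S) = 4 ^ q" .
  qed
  also have "\<dots> = (m choose q) * 4 ^ q" using n_subsets[of "{..<m}" q] by (simp add: \<S>_def)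
  finally show ?thesis .
qed

lemma ip_self:
  assumes "x \<in> layer m q"
  shows "ip m x x = int q"
proof -
  have "ip m x x = (\<Sum>i<m. if x i \<noteq> (0,0) then 1 else 0)"
    unfolding ip_def
  proof (rule sum.cong[OF refl])
    fix i assume "i \<in> {..<m}"
    then have "x i \<in> gunits" using assms gvecs_coord by (auto simp: layer_def)
    then show "fst (x i) * fst (x i) + snd (x i) * snd (x i) = (if x i \<noteq> (0,0) then 1 else 0)"
      by (auto simp: gunits_def)
  qed
  also have "\<dots> = (\<Sum>i\<in>gsupp m x. 1)"
    by (intro sum.mono_neutral_cong_right) (auto simp: gsupp_def)
  finally show ?thesis using assms by (simp add: layer_def)
qed

lemma ip_sub_self:
  "(\<Sum>i<m. (fst (x i) - fst (y i))\<^sup>2 + (snd (x i) - snd (y i))\<^sup>2) = ip m x x + ip m y y - 2 * ip m x y"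
  by (simp add: ip_def sum.distrib sum_subtractf sum_distrib_left power2_eq_square algebra_simps)

lemma ip_add_self:
  "(\<Sum>i<m. (fst (x i) + fst (y i))\<^sup>2 + (snd (x i) + snd (y i))\<^sup>2) = ip m x x + ip m y y + 2 * ip m x y"
  by (simp add: ip_def sum.distrib sum_distrib_left power2_eq_square algebra_simps)

lemma ip_le:
  assumes "x \<in> layer m q" "y \<in> layer m q"
  shows "ip m x y \<le> int q"
proof -
  have "0 \<le> (\<Sum>i<m. (fst (x i) - fst (y i))\<^sup>2 + (snd (x i) - snd (y i))\<^sup>2)"
    by (intro sum_nonneg) simp
  then show ?thesis unfolding ip_sub_self using ip_self[OF assms(1)] ip_self[OF assms(2)] by simp
qed

lemma ip_ge:
  assumes "x \<in> layer m q" "y \<in> layer m q"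
  shows "- int q \<le> ip m x y"
proof -
  have "0 \<le> (\<Sum>i<m. (fst (x i) + fst (y i))\<^sup>2 + (snd (x i) + snd (y i))\<^sup>2)"
    by (intro sum_nonneg) simp
  then show ?thesis unfolding ip_add_self using ip_self[OF assms(1)] ip_self[OF assms(2)] by simp
qed

lemma ip_eq_imp_eq:
  assumes "x \<in> layer m q" "y \<in> layer m q" "ip m x y = int q"
  shows "x = y"
proof (rule gvecs_eqI)
  show "x \<in> gvecs m" "y \<in> gvecs m" using assms by (auto simp: layer_def)
  fix i assume i: "i < m"
  have "(\<Sum>i<m. (fst (x i) - fst (y i))\<^sup>2 + (snd (x i) - snd (y i))\<^sup>2) = 0"
    unfolding ip_sub_self using ip_self[OF assms(1)] ip_self[OF assms(2)] assms by simp
  then have "(fst (x i) - fst (y i))\<^sup>2 + (snd (x i) - snd (y i))\<^sup>2 = 0"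
    using i by (subst (asm) sum_nonneg_eq_0_iff) auto
  then show "x i = y i" by (simp add: sum_power2_eq_zero_iff prod_eq_iff)
qed

lemma ip_eq_uminus_imp:
  assumes "x \<in> layer m q" "y \<in> layer m q" "ip m x y = - int q" "i < m"
  shows "fst (y i) = - fst (x i) \<and> snd (y i) = - snd (x i)"
proof -
  have "(\<Sum>i<m. (fst (x i) + fst (y i))\<^sup>2 + (snd (x i) + snd (y i))\<^sup>2) = 0"
    unfolding ip_add_self using ip_self[OF assms(1)] ip_self[OF assms(2)] assms by simp
  then have "(fst (x i) + fst (y i))\<^sup>2 + (snd (x i) + snd (y i))\<^sup>2 = 0"
    using assms(4) by (subst (asm) sum_nonneg_eq_0_iff) auto
  then show ?thesis by (auto simp: sum_power2_eq_zero_iff)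
qed

text \<open>On nonzero units \<open>fst + snd\<close> is 1 for 1 and i, and -1 for -1 and -i, so
  this encodes the parity of the number of negative entries.\<close>

definition sign_prod :: "nat \<Rightarrow> (nat \<Rightarrow> int \<times> int) \<Rightarrow> int" where
  "sign_prod m x = (\<Prod>i\<in>gsupp m x. fst (x i) + snd (x i))"

text \<open>Nonzero imaginary parts are 1 or -1, so the sum has the parity of their number.\<close>

definition imag_parity :: "nat \<Rightarrow> (nat \<Rightarrow> int \<times> int) \<Rightarrow> bool" where
  "imag_parity m x \<longleftrightarrow> even (\<Sum>i<m. snd (x i))"

definition sign_class :: "nat \<Rightarrow> nat \<Rightarrow> bool \<Rightarrow> bool \<Rightarrow> (nat \<Rightarrow> int \<times> int) set" where
  "sign_class m q r s = {x \<in> layer m q. imag_parity m x = r \<and> (sign_prod m x = 1) = s}"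

lemma sign_prod_cases:
  assumes "x \<in> gvecs m"
  shows "sign_prod m x = 1 \<or> sign_prod m x = -1"
proof -
  have "\<bar>sign_prod m x\<bar> = (\<Prod>i\<in>gsupp m x. \<bar>fst (x i) + snd (x i)\<bar>)"
    by (simp add: sign_prod_def abs_prod)
  also have "\<dots> = 1"
  proof (rule prod.neutral, rule ballI)
    fix i assume "i \<in> gsupp m x"
    then show "\<bar>fst (x i) + snd (x i)\<bar> = 1"
      using gvecs_coord[OF assms, of i] by (auto simp: gsupp_def gunits_def)
  qed
  finally show ?thesis by linarith
qed

text \<open>Negation reverses an odd number \<open>q\<close> of signs and hence changes
  \<open>sign_prod\<close>.\<close>

lemma not_antipodal:
  assumes "odd q" "x \<in> sign_class m q r s" "y \<in> sign_class m q r s"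
  shows "\<not> (\<forall>i<m. fst (y i) = - fst (x i) \<and> snd (y i) = - snd (x i))"
proof
  assume neg: "\<forall>i<m. fst (y i) = - fst (x i) \<and> snd (y i) = - snd (x i)"
  have eq: "gsupp m y = gsupp m x" using neg by (auto simp: gsupp_def prod_eq_iff)
  have "sign_prod m y = (\<Prod>i\<in>gsupp m x. (-1) * (fst (x i) + snd (x i)))"
    unfolding sign_prod_def eq using neg by (intro prod.cong) (auto simp: gsupp_def)
  also have "\<dots> = (-1) ^ card (gsupp m x) * sign_prod m x"
    unfolding prod.distrib sign_prod_def by simp
  also have "\<dots> = - sign_prod m x" using assms by (auto simp: sign_class_def layer_def)
  finally have "sign_prod m y = - sign_prod m x" .
  moreover have "x \<in> gvecs m" "(sign_prod m x = 1) = (sign_prod m y = 1)"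
    using assms by (auto simp: sign_class_def layer_def)
  ultimately show False using sign_prod_cases[of x m] by auto
qed

text \<open>Modulo 2 a point of the common support contributes 1 plus both imaginary parts: the
  product is odd exactly if both entries are real or both imaginary. The total is \<open>q\<close>
  plus two sums of equal parity, which is why the class fixes \<open>imag_parity\<close>.\<close>

lemma odd_ip_same_supp:
  assumes "odd q" "x \<in> sign_class m q r s" "y \<in> sign_class m q r s" "gsupp m x = gsupp m y"
  shows "odd (ip m x y)"
proof -
  have gx: "x \<in> gvecs m" and gy: "y \<in> gvecs m" using assms by (auto simp: sign_class_def layer_def)
  let ?f = "\<lambda>i. fst (x i) * fst (y i) + snd (x i) * snd (y i)"
  let ?g = "\<lambda>i. (if i \<in> gsupp m x then 1 else 0) + snd (x i) + snd (y i)"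
  have "even (?f i - ?g i)" if i: "i < m" for i
  proof -
    have "x i \<in> gunits" "y i \<in> gunits" using i gvecs_coord gx gy by auto
    moreover have "x i = (0,0) \<longleftrightarrow> y i = (0,0)" using assms(4) i by (auto simp: gsupp_def)
    moreover have "i \<in> gsupp m x \<longleftrightarrow> x i \<noteq> (0,0)" using i by (simp add: gsupp_def)
    ultimately show ?thesis by (auto simp: gunits_def)
  qed
  then have "even (\<Sum>i<m. ?f i - ?g i)" by (intro dvd_sum) auto
  moreover have "(\<Sum>i<m. ?f i - ?g i) = ip m x y - (\<Sum>i<m. ?g i)" by (simp add: ip_def sum_subtractf)
  moreover have "(\<Sum>i<m. ?g i) = int q + (\<Sum>i<m. snd (x i)) + (\<Sum>i<m. snd (y i))"
  proof -
    have "(\<Sum>i<m. if i \<in> gsupp m x then 1 else 0 :: int) = (\<Sum>i\<in>gsupp m x. 1)"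
      by (intro sum.mono_neutral_cong_right) (auto simp: gsupp_def)
    then show ?thesis using assms(2) by (simp add: sum.distrib sign_class_def layer_def)
  qed
  moreover have "even (\<Sum>i<m. snd (x i)) = even (\<Sum>i<m. snd (y i))"
    using assms by (simp add: sign_class_def imag_parity_def)
  ultimately show ?thesis using assms(1) by auto
qed

lemma exists_large_sign_class:
  "\<exists>r s. card (layer m q) \<le> 4 * card (sign_class m q r s)"
proof (rule ccontr)
  assume neg: "\<not> ?thesis"
  have "layer m q = (sign_class m q True True \<union> sign_class m q True False) \<union>
      (sign_class m q False True \<union> sign_class m q False False)"
    by (auto simp: sign_class_def)
  then have "card (layer m q) \<le> (card (sign_class m q True True) + card (sign_class m q True False)) +
      (card (sign_class m q False True) + card (sign_class m q False False))"
    using card_Un_le[of "sign_class m q True True \<union> sign_class m q True False"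
        "sign_class m q False True \<union> sign_class m q False False"]
      card_Un_le[of "sign_class m q True True" "sign_class m q True False"]
      card_Un_le[of "sign_class m q False True" "sign_class m q False False"] by simp
  moreover have "4 * card (sign_class m q r s) < card (layer m q)" for r s using neg by (meson not_le)
  note this[of True True] this[of True False] this[of False True] this[of False False]
  ultimately show False by linarith
qed

text \<open>Inner products lie between -q and q, and the ends mean x = y or x = -y. The latter does
  not occur in the class, so 0 is the only multiple of \<open>q\<close> possible for distinct
  members.\<close>

lemma sign_class_independent_le:
  fixes p :: int
  assumes p: "prime p" and q: "int q = p ^ k" "odd q"
    and I: "I \<subseteq> sign_class m q r s" and indep: "\<And>x y. x \<in> I \<Longrightarrow> y \<in> I \<Longrightarrow> ip m x y \<noteq> 0"
  shows "card I \<le> card (exponents m (q - 1))"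
proof (rule frankl_wilson_bound[OF p q(1)])
  show q0: "q > 0" using q(2) by (rule odd_pos)
  show "I \<subseteq> gvecs m" using I by (auto simp: sign_class_def layer_def)
  show "ip m x x = int q" if "x \<in> I" for x using that I by (intro ip_self) (auto simp: sign_class_def)
  fix x y assume x: "x \<in> I" and y: "y \<in> I" and ne: "x \<noteq> y"
  have l: "x \<in> layer m q" "y \<in> layer m q" using x y I by (auto simp: sign_class_def)
  show "\<not> int q dvd ip m x y"
  proof
    assume "int q dvd ip m x y"
    moreover have "ip m x y \<noteq> int q" using ip_eq_imp_eq[OF l] ne by blast
    moreover have "ip m x y \<noteq> - int q"
      using ip_eq_uminus_imp[OF l] not_antipodal[OF q(2), of x m r s y] x y I by blast
    ultimately show False
      using ip_le[OF l] ip_ge[OF l] indep[OF x y] dvd_imp_le_int[of "ip m x y" "int q"] by linarith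
  qed
qed

section \<open>Geometric realisation\<close>

lemma sum_square_eq_sum_triangle:
  fixes f :: "nat \<Rightarrow> nat \<Rightarrow> real"
  assumes "\<And>i j. f i j = f j i"
  shows "(\<Sum>i<n. \<Sum>j<n. f i j) = (\<Sum>j<n. \<Sum>i\<le>j. (if i = j then 1 else 2) * f i j)"
proof (induction n)
  case (Suc n)
  have "(\<Sum>i\<le>n. (if i = n then 1 else 2) * f i n) = (\<Sum>i<n. 2 * f i n) + f n n"
    by (simp add: lessThan_Suc_atMost[symmetric])
  moreover have "(\<Sum>i<Suc n. \<Sum>j<Suc n. f i j)
      = (\<Sum>i<n. \<Sum>j<n. f i j) + (\<Sum>i<n. f i n) + (\<Sum>j<n. f n j) + f n n"
    by (simp add: sum.distrib)
  moreover have "(\<Sum>j<n. f n j) = (\<Sum>i<n. f i n)" by (intro sum.cong assms refl)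
  ultimately show ?case using Suc by (simp add: sum_distrib_left[symmetric])
qed simp

lemma sum_tensor_diff_squares:
  fixes p p' :: "nat \<Rightarrow> real"
  shows "(\<Sum>i<n. \<Sum>j<n. (p i * p j - p' i * p' j)\<^sup>2)
    = (\<Sum>i<n. (p i)\<^sup>2)\<^sup>2 + (\<Sum>i<n. (p' i)\<^sup>2)\<^sup>2 - 2 * (\<Sum>i<n. p i * p' i)\<^sup>2"
proof -
  have e: "(p i * p j - p' i * p' j)\<^sup>2
      = (p i)\<^sup>2 * (p j)\<^sup>2 + (p' i)\<^sup>2 * (p' j)\<^sup>2 - 2 * ((p i * p' i) * (p j * p' j))" for i j
    by (simp add: power2_eq_square algebra_simps)
  have s: "(\<Sum>i<n. a i)\<^sup>2 = (\<Sum>i<n. \<Sum>j<n. a i * a j)" for a :: "nat \<Rightarrow> real"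
    by (simp add: power2_eq_square sum_product)
  show ?thesis by (simp only: e s sum.distrib sum_subtractf sum_distrib_left)
qed

text \<open>Equality case of Cauchy-Schwarz, read off from |p - s p'|^2 with s = 1 or s =
  -1.\<close>

lemma equal_or_antipodal:
  fixes p p' :: "nat \<Rightarrow> real"
  assumes "(\<Sum>i<n. (p i)\<^sup>2) = Q" "(\<Sum>i<n. (p' i)\<^sup>2) = Q" "(\<Sum>i<n. p i * p' i)\<^sup>2 = Q\<^sup>2"
  shows "(\<forall>i<n. p i = p' i) \<or> (\<forall>i<n. p i = - p' i)"
proof -
  have e: "(\<Sum>i<n. (p i - s * p' i)\<^sup>2) = Q + s\<^sup>2 * Q - 2 * s * (\<Sum>i<n. p i * p' i)" for s
  proof -
    have "(p i - s * p' i)\<^sup>2 = (p i)\<^sup>2 + s\<^sup>2 * (p' i)\<^sup>2 - 2 * s * (p i * p' i)" for i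
      by (simp add: power2_eq_square algebra_simps)
    then show ?thesis
      by (simp only: sum.distrib sum_subtractf sum_distrib_left[symmetric] assms)
  qed
  have z: "\<forall>i<n. p i = s * p' i" if "(\<Sum>i<n. (p i - s * p' i)\<^sup>2) = 0" for s
    using that by (subst (asm) sum_nonneg_eq_0_iff) auto
  consider "(\<Sum>i<n. p i * p' i) = Q" | "(\<Sum>i<n. p i * p' i) = - Q"
    using assms(3) by (auto simp: power2_eq_iff)
  then show ?thesis
  proof cases
    case 1
    then show ?thesis using z[of 1] e[of 1] by auto
  next
    case 2
    then show ?thesis using z[of "-1"] e[of "-1"] by auto
  qed
qed

lemma card_triangle: "card (SIGMA j:{..<2 * m}. {..j}) = m * (2 * m + 1)"
proof -
  have "card (SIGMA j:{..<n}. {..j}) * 2 = n * (n + 1)" for n :: nat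
  proof -
    have "card (SIGMA j:{..<n}. {..j}) = (\<Sum>j<n. Suc j)" by (subst card_SigmaI) auto
    moreover have "(\<Sum>j<n. Suc j) * 2 = n * (n + 1)" by (induction n) auto
    ultimately show ?thesis by simp
  qed
  from this[of "2 * m"] show ?thesis by simp
qed

text \<open>The map \<open>p \<mapsto> p \<otimes> p\<close> into symmetric tensors turns orthogonality into maximal distance, since
  \<open>|p \<otimes> p - p' \<otimes> p'|^2 = 2 Q^2 - 2 \<langle>p, p'\<rangle>^2\<close> for vectors of squared length \<open>Q\<close>.\<close>

lemma diameter_graph_of_orthogonal:
  fixes P :: "nat \<Rightarrow> nat \<Rightarrow> real"
  assumes fin: "finite V" and simple: "simple_graph V E" and d: "m * (2 * m + 1) \<le> d"
    and norm: "\<And>v. v \<in> V \<Longrightarrow> (\<Sum>i<2 * m. (P v i)\<^sup>2) = Q"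
    and orth: "\<And>u v. E u v \<Longrightarrow> (\<Sum>i<2 * m. P u i * P v i) = 0"
    and inj: "\<And>u v. u \<in> V \<Longrightarrow> v \<in> V \<Longrightarrow>
      (\<forall>i<2 * m. P u i = P v i) \<or> (\<forall>i<2 * m. P u i = - P v i) \<Longrightarrow> u = v"
  shows "diameter_graph d V E"
proof -
  let ?n = "2 * m" and ?M = "m * (2 * m + 1)"
  define T where "T = (SIGMA j:{..<?n}. {..j})"
  have "finite T" unfolding T_def by auto
  then obtain ix where ix: "bij_betw ix {..<?M} T"
    using ex_bij_betw_nat_finite[of T] card_triangle[of m] unfolding T_def
    by (auto simp: atLeast0LessThan)
  \<comment> \<open>An off-diagonal entry of a symmetric tensor counts twice in the norm; it is
    stored once with weight sqrt 2, which gives dimension \<open>m * (2 * m + 1)\<close> instead of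
    \<open>(2 * m)\<^sup>2\<close>.\<close>
  define tens where "tens v = (\<lambda>(j, i). (if i = j then 1 else sqrt 2) * (P v i * P v j))" for v
  define \<phi> where "\<phi> v l = (if l < ?M then tens v (ix l) else 0)" for v l
  have dist2: "(\<Sum>l<d. (\<phi> u l - \<phi> v l)\<^sup>2) = 2 * Q\<^sup>2 - 2 * (\<Sum>i<?n. P u i * P v i)\<^sup>2"
    if "u \<in> V" "v \<in> V" for u v
  proof -
    have "(\<Sum>l<d. (\<phi> u l - \<phi> v l)\<^sup>2) = (\<Sum>l<?M. (tens u (ix l) - tens v (ix l))\<^sup>2)"
      using d by (intro sum.mono_neutral_cong_right) (auto simp: \<phi>_def)
    also have "\<dots> = (\<Sum>t\<in>T. (tens u t - tens v t)\<^sup>2)"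
      by (rule sum.reindex_bij_betw[OF ix])
    also have "\<dots> = (\<Sum>j<?n. \<Sum>i\<le>j. (tens u (j, i) - tens v (j, i))\<^sup>2)"
      unfolding T_def by (subst sum.Sigma) (auto simp: case_prod_unfold)
    also have "\<dots> = (\<Sum>j<?n. \<Sum>i\<le>j. (if i = j then 1 else 2) * (P u i * P u j - P v i * P v j)\<^sup>2)"
      by (intro sum.cong refl)
        (auto simp: tens_def power_mult_distrib right_diff_distrib[symmetric])
    also have "\<dots> = (\<Sum>i<?n. \<Sum>j<?n. (P u i * P u j - P v i * P v j)\<^sup>2)"
      by (rule sum_square_eq_sum_triangle[symmetric]) (simp add: mult.commute)
    finally show ?thesis using norm that by (simp add: sum_tensor_diff_squares)
  qed
  have "inj_on \<phi> V"
  proof (rule inj_onI)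
    fix u v assume uv: "u \<in> V" "v \<in> V" "\<phi> u = \<phi> v"
    then have "(\<Sum>i<?n. P u i * P v i)\<^sup>2 = Q\<^sup>2" using dist2[OF uv(1,2)] by simp
    then show "u = v" using equal_or_antipodal[OF norm norm] uv inj by blast
  qed
  moreover have "in_Rd d (\<phi> v)" for v using d by (auto simp: in_Rd_def \<phi>_def)
  moreover have "edist d (\<phi> u) (\<phi> v) = Max {edist d (\<phi> x) (\<phi> y) | x y. x \<in> V \<and> y \<in> V}" if uv: "E u v" for u v
  proof -
    have V: "u \<in> V" "v \<in> V" using uv simple by (auto simp: simple_graph_def)
    let ?D = "{edist d (\<phi> x) (\<phi> y) | x y. x \<in> V \<and> y \<in> V}"
    have D: "?D = (\<lambda>(x, y). edist d (\<phi> x) (\<phi> y)) ` (V \<times> V)" by auto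
    have "edist d (\<phi> u) (\<phi> v) = sqrt (2 * Q\<^sup>2)"
      unfolding edist_def dist2[OF V] orth[OF uv] by simp
    moreover have "edist d (\<phi> x) (\<phi> y) \<le> sqrt (2 * Q\<^sup>2)" if "x \<in> V" "y \<in> V" for x y
      unfolding edist_def dist2[OF that] by simp
    moreover have "finite ?D" unfolding D using fin by simp
    moreover have "edist d (\<phi> u) (\<phi> v) \<in> ?D" using V by blast
    ultimately have "Max ?D = edist d (\<phi> u) (\<phi> v)" by (intro Max_eqI) auto
    then show ?thesis by simp
  qed
  ultimately show ?thesis unfolding diameter_graph_def by blast
qed

definition real_coords :: "(nat \<Rightarrow> complex) \<Rightarrow> nat \<Rightarrow> real" where
  "real_coords z j = (if even j then Re (z (j div 2)) else Im (z (j div 2)))"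

lemma sum_real_coords:
  "(\<Sum>j<2 * m. real_coords z j * real_coords w j) = (\<Sum>i<m. Re (z i) * Re (w i) + Im (z i) * Im (w i))"
  by (induction m) (auto simp: real_coords_def)

lemma real_coords_eq_iff:
  "(\<forall>j<2 * m. real_coords z j = s * real_coords w j) \<longleftrightarrow> (\<forall>i<m. z i = of_real s * w i)"
proof (intro iffI allI impI)
  fix i assume *: "\<forall>j<2 * m. real_coords z j = s * real_coords w j" and i: "i < m"
  have "real_coords z (2 * i) = s * real_coords w (2 * i)"
    "real_coords z (Suc (2 * i)) = s * real_coords w (Suc (2 * i))" using * i by auto
  then show "z i = of_real s * w i" by (simp add: real_coords_def complex_eq_iff)
next
  fix j assume "\<forall>i<m. z i = of_real s * w i" "j < 2 * m"
  then have "z (j div 2) = of_real s * w (j div 2)" by auto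
  then show "real_coords z j = s * real_coords w j" by (simp add: real_coords_def)
qed

text \<open>All angles stay in [0, pi/2), so no two of them differ by the angle between two
  units.\<close>

definition twist_angle :: "nat \<Rightarrow> nat \<Rightarrow> real" where
  "twist_angle L j = pi / 2 * (real j / real L)"

definition twisted :: "nat \<Rightarrow> (nat \<Rightarrow> int \<times> int) \<times> (nat \<Rightarrow> nat) \<Rightarrow> nat \<Rightarrow> complex" where
  "twisted L v i = cis (twist_angle L (snd v i)) * Complex (fst (fst v i)) (snd (fst v i))"

lemma twist_angle_diff_less:
  assumes "j < L" "j' < L"
  shows "\<bar>twist_angle L j - twist_angle L j'\<bar> < pi / 2"
proof -
  have r: "0 \<le> twist_angle L k \<and> twist_angle L k < pi / 2" if "k < L" for k
  proof -
    have "real k / real L < 1" using that by simp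
    then have "pi / 2 * (real k / real L) < pi / 2 * 1" by (intro mult_strict_left_mono) auto
    then show ?thesis by (simp add: twist_angle_def)
  qed
  show ?thesis using r[OF assms(1)] r[OF assms(2)] by linarith
qed

text \<open>A rotation by less than pi/2 that carries a unit to an element of \<open>gunits\<close>
  is trivial: its cosine is, up to sign, a coordinate of the image, and it is positive, hence
  1.\<close>

lemma twist_unit_eq:
  assumes "a \<in> gunits" "b \<in> gunits" "a \<noteq> (0,0)" "j < L" "j' < L"
    and eq: "cis (twist_angle L j) * Complex (fst a) (snd a) = cis (twist_angle L j') * Complex (fst b) (snd b)"
  shows "j = j' \<and> a = b"
proof -
  define \<delta> where "\<delta> = twist_angle L j - twist_angle L j'"
  have \<delta>: "\<bar>\<delta>\<bar> < pi / 2" unfolding \<delta>_def by (rule twist_angle_diff_less) fact+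
  have "cis \<delta> * Complex (fst a) (snd a) = cis (- twist_angle L j') * (cis (twist_angle L j) * Complex (fst a) (snd a))"
    by (simp add: \<delta>_def cis_mult mult.assoc[symmetric])
  also have "\<dots> = Complex (fst b) (snd b)" unfolding eq by (simp add: cis_mult mult.assoc[symmetric])
  finally have rot: "cos \<delta> * fst a - sin \<delta> * snd a = fst b" "cos \<delta> * snd a + sin \<delta> * fst a = snd b"
    by (auto simp: complex_eq_iff algebra_simps)
  have pos: "cos \<delta> > 0" using \<delta> by (intro cos_gt_zero_pi) auto
  have "cos \<delta> \<in> {0, 1, -1}" using assms(1-3) rot by (auto simp: gunits_def)
  then have c1: "cos \<delta> = 1" using pos by auto
  then have s0: "sin \<delta> = 0" using sin_cos_squared_add[of \<delta>] by simp
  have "\<delta> = 0" using s0 \<delta> by (subst (asm) sin_zero_pi_iff) auto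
  then have "real j = real j'" using assms(4) by (auto simp: \<delta>_def twist_angle_def)
  then show ?thesis using rot c1 s0 by (simp add: prod_eq_iff)
qed

lemma Complex_unit_eq_0_iff: "Complex (real_of_int (fst a)) (real_of_int (snd a)) = 0 \<longleftrightarrow> a = (0,0)"
  by (auto simp: complex_eq_iff prod_eq_iff)

lemma cis_mult_inner:
  "Re (cis \<theta> * a) * Re (cis \<theta> * b) + Im (cis \<theta> * a) * Im (cis \<theta> * b) = Re a * Re b + Im a * Im b"
proof -
  have "(c * a1 - s * a2) * (c * b1 - s * b2) + (c * a2 + s * a1) * (c * b2 + s * b1)
      = (s\<^sup>2 + c\<^sup>2) * (a1 * b1 + a2 * b2)" for c s a1 a2 b1 b2 :: real
    by (simp add: power2_eq_square algebra_simps)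
  from this[of "cos \<theta>" "Re a" "sin \<theta>" "Im a" "Re b" "Im b"] show ?thesis by simp
qed

text \<open>Coordinates outside one of the supports contribute 0; on the common support the angles
  agree, and a common rotation preserves the product.\<close>

lemma sum_twisted_inner:
  assumes "\<And>i. i \<in> gsupp m x \<inter> gsupp m y \<Longrightarrow> \<tau> i = \<tau>' i"
  shows "(\<Sum>i<m. Re (twisted L (x, \<tau>) i) * Re (twisted L (y, \<tau>') i) + Im (twisted L (x, \<tau>) i) * Im (twisted L (y, \<tau>') i))
    = of_int (ip m x y)"
  unfolding ip_def of_int_sum
proof (rule sum.cong[OF refl])
  fix i assume i: "i \<in> {..<m}"
  show "Re (twisted L (x, \<tau>) i) * Re (twisted L (y, \<tau>') i) + Im (twisted L (x, \<tau>) i) * Im (twisted L (y, \<tau>') i)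
    = of_int (fst (x i) * fst (y i) + snd (x i) * snd (y i))"
  proof (cases "i \<in> gsupp m x \<inter> gsupp m y")
    case True
    then show ?thesis
      by (simp only: twisted_def fst_conv snd_conv assms[OF True] cis_mult_inner complex.sel of_int_add of_int_mult)
  next
    case False
    then have "x i = (0,0) \<or> y i = (0,0)" using i by (auto simp: gsupp_def)
    then show ?thesis by (auto simp: twisted_def)
  qed
qed

theorem sign_class_diameter_graph:
  fixes p :: int
  assumes p: "prime p" and q: "int q = p ^ e" "odd q"
    and k: "k > 0" "k * card (exponents m (q - 1)) < card (sign_class m q r s)"
    and d: "m * (2 * m + 1) \<le> d" and g: "g > 0"
  shows "\<exists>V E. finite V \<and> simple_graph V E \<and> diameter_graph d V E \<and> girth_ge V E g \<and>
    k < chromatic_number V E"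
proof -
  let ?X = "sign_class m q r s"
  have XD: "x \<in> layer m q" "x \<in> gvecs m" if "x \<in> ?X" for x
    using that by (auto simp: sign_class_def layer_def)
  interpret supported_graph ?X "gsupp m" "\<lambda>x y. ip m x y = 0" m q "card (exponents m (q - 1))" k
  proof
    show "finite ?X" using finite_layer by (simp add: sign_class_def)
    show "gsupp m x \<subseteq> {..<m} \<and> card (gsupp m x) = q" if "x \<in> ?X" for x
      using that by (auto simp: sign_class_def layer_def gsupp_def)
    show "gsupp m x \<noteq> gsupp m y" if "x \<in> ?X" "y \<in> ?X" "ip m x y = 0" for x y
      using odd_ip_same_supp[OF q(2) that(1,2)] that(3) by auto
    show "card I \<le> card (exponents m (q - 1))"
      if "I \<subseteq> ?X" "\<And>x y. x \<in> I \<Longrightarrow> y \<in> I \<Longrightarrow> ip m x y \<noteq> 0" for I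
      by (rule sign_class_independent_le[OF p q that])
  qed (use k in auto)
  obtain L h E where h: "inj_on h (verts L)" and simple: "simple_graph (h ` verts L) E"
    and girth: "girth_ge (h ` verts L) E g" and chrom: "k < chromatic_number (h ` verts L) E"
    and edge: "\<And>u v. E u v \<Longrightarrow> \<exists>t\<in>twists L. \<exists>x\<in>?X. \<exists>y\<in>?X. (ip m x y = 0 \<or> ip m y x = 0) \<and>
        u = h (vert t x) \<and> v = h (vert t y)"
    using exists_sparse_blowup[OF g] by blast
  define P where "P v = real_coords (twisted L (the_inv_into (verts L) h v))" for v
  have Ph: "P (h w) = real_coords (twisted L w)" if "w \<in> verts L" for w
    by (simp add: P_def the_inv_into_f_f[OF h that])
  have "diameter_graph d (h ` verts L) E"
  proof (rule diameter_graph_of_orthogonal[OF _ simple d])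
    show "finite (h ` verts L)" using finite_verts by blast
    fix v assume "v \<in> h ` verts L"
    then obtain x \<tau> where w: "(x, \<tau>) \<in> verts L" "v = h (x, \<tau>)" by auto
    then have "x \<in> ?X" by (simp add: verts_def)
    then show "(\<Sum>i<2 * m. (P v i)\<^sup>2) = real q"
      unfolding w(2) Ph[OF w(1)] power2_eq_square sum_real_coords
      using ip_self[OF XD(1)] sum_twisted_inner[of m x x \<tau> \<tau> L] by simp
  next
    fix u v assume "E u v"
    then obtain t x y where t: "t \<in> twists L" "x \<in> ?X" "y \<in> ?X" "ip m x y = 0 \<or> ip m y x = 0"
      "u = h (vert t x)" "v = h (vert t y)" using edge by blast
    have "ip m y x = ip m x y" by (simp add: ip_def mult.commute)
    then have "ip m x y = 0" using t(4) by auto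
    then show "(\<Sum>i<2 * m. P u i * P v i) = 0"
      unfolding t(5,6) Ph[OF vert_in_verts[OF t(2,1)]] Ph[OF vert_in_verts[OF t(3,1)]] sum_real_coords
      by (subst sum_twisted_inner) auto
  next
    fix u v assume uv: "u \<in> h ` verts L" "v \<in> h ` verts L"
      and *: "(\<forall>i<2 * m. P u i = P v i) \<or> (\<forall>i<2 * m. P u i = - P v i)"
    obtain x \<tau> where a: "(x, \<tau>) \<in> verts L" "u = h (x, \<tau>)" using uv by auto
    obtain y \<sigma> where b: "(y, \<sigma>) \<in> verts L" "v = h (y, \<sigma>)" using uv by auto
    have X: "x \<in> ?X" "y \<in> ?X" and \<tau>: "\<tau> \<in> PiE (gsupp m x) (\<lambda>_. {..<L})" "\<sigma> \<in> PiE (gsupp m y) (\<lambda>_. {..<L})"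
      using a b by (auto simp: verts_def)
    \<comment> \<open>Both alternatives are treated together, with \<open>P u\<close> equal to
      \<open>c\<close> times \<open>P v\<close>; \<open>neg c\<close> maps units to units.\<close>
    define neg where "neg = (\<lambda>c :: int. \<lambda>v :: int \<times> int. (c * fst v, c * snd v))"
    obtain c :: int where c: "c = 1 \<or> c = -1" and "\<forall>i<2 * m. P u i = of_int c * P v i"
    proof (cases "\<forall>i<2 * m. P u i = P v i")
      case True
      then show ?thesis using that[of 1] by simp
    next
      case False
      with * have "\<forall>i<2 * m. P u i = - P v i" by blast
      then show ?thesis using that[of "-1"] by simp
    qed
    then have eq: "twisted L (x, \<tau>) i = of_real (of_int c) * twisted L (y, \<sigma>) i" if "i < m" for i
      using that unfolding a(2) b(2) Ph[OF a(1)] Ph[OF b(1)] real_coords_eq_iff by blast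
    have unit: "x i \<in> gunits" "y i \<in> gunits" "neg c (y i) \<in> gunits" if "i < m" for i
    proof -
      show "x i \<in> gunits" by (rule gvecs_coord[OF XD(2)[OF X(1)] that])
      show "y i \<in> gunits" by (rule gvecs_coord[OF XD(2)[OF X(2)] that])
      then show "neg c (y i) \<in> gunits" using c by (auto simp: neg_def gunits_def)
    qed
    have eq': "cis (twist_angle L (\<tau> i)) * Complex (fst (x i)) (snd (x i))
        = cis (twist_angle L (\<sigma> i)) * Complex (fst (neg c (y i))) (snd (neg c (y i)))" if "i < m" for i
      using eq[OF that] by (simp add: twisted_def neg_def complex_eq_iff algebra_simps)
    have supp: "x i = (0,0) \<longleftrightarrow> y i = (0,0)" if "i < m" for i
    proof -
      have "Complex (fst (x i)) (snd (x i)) = 0 \<longleftrightarrow> Complex (fst (neg c (y i))) (snd (neg c (y i))) = 0"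
        using arg_cong[OF eq'[OF that], of "\<lambda>z. z = 0"] by simp
      then show ?thesis unfolding Complex_unit_eq_0_iff using c by (auto simp: neg_def prod_eq_iff)
    qed
    have ne: "\<tau> i = \<sigma> i \<and> x i = neg c (y i)" if i: "i \<in> gsupp m x" for i
    proof (rule twist_unit_eq[OF _ _ _ _ _ eq'])
      have im: "i < m" "i \<in> gsupp m y" using i supp by (auto simp: gsupp_def)
      then show "i < m" "x i \<in> gunits" "neg c (y i) \<in> gunits" using unit by auto
      show "x i \<noteq> (0,0)" using i by (simp add: gsupp_def)
      show "\<tau> i < L" "\<sigma> i < L" using \<tau> i im by (auto simp: PiE_iff)
    qed
    have all: "x i = neg c (y i)" if "i < m" for i
    proof (cases "i \<in> gsupp m x")
      case False
      then show ?thesis using that supp[OF that] by (auto simp: gsupp_def neg_def)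
    qed (use ne in blast)
    \<comment> \<open>The tensor square does not see the sign of a vector, so the class must not
      contain a vector together with its negative.\<close>
    have "c \<noteq> -1"
    proof
      assume "c = -1"
      then have "\<forall>i<m. fst (x i) = - fst (y i) \<and> snd (x i) = - snd (y i)" using all by (simp add: neg_def)
      then show False using not_antipodal[OF q(2) X(2,1)] by blast
    qed
    then have "c = 1" using c by simp
    then have xy: "x = y" using all by (intro gvecs_eqI[OF XD(2)[OF X(1)] XD(2)[OF X(2)]]) (simp add: neg_def)
    have "\<tau> = \<sigma>"
      using \<tau> ne unfolding xy by (intro PiE_ext[of \<tau> "gsupp m y" "\<lambda>_. {..<L}" \<sigma>]) auto
    with xy show "u = v" by (simp add: a b)
  qed
  then show ?thesis using simple girth chrom finite_verts by blast
qed

section \<open>Asymptotics\<close>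

lemma binomial_ratio:
  assumes "j < m" shows "Suc j * (m choose Suc j) = (m - j) * (m choose j)"
proof -
  obtain n where n: "m = Suc n" using \<open>j < m\<close> by (cases m) auto
  show ?thesis using binomial_absorb_comp[of m j] Suc_times_binomial[of j n] by (simp add: n)
qed

text \<open>Among the m + 1 terms of the expansion of (q + (m - q))^m the one of index
  \<open>q\<close> is the largest, by the ratio of consecutive terms.\<close>

lemma pow_self_le_binomial:
  assumes "q \<le> m"
  shows "m ^ m \<le> (m + 1) * ((m choose q) * q ^ q * (m - q) ^ (m - q))"
proof -
  define r where "r = m - q"
  have m: "m = q + r" using assms by (simp add: r_def)
  define T where "T j = (m choose j) * q ^ j * r ^ (m - j)" for j
  have rec: "T (Suc j) * (Suc j * r) = T j * ((m - j) * q)" if "j < m" for j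
  proof -
    have "r ^ (m - j) = r ^ (m - Suc j) * r" using Suc_diff_Suc[OF that] by (metis power_Suc2)
    then have "T j * ((m - j) * q) = ((m - j) * (m choose j)) * (q ^ Suc j * (r ^ (m - Suc j) * r))"
      unfolding T_def by (simp only: ac_simps power_Suc)
    also have "\<dots> = T (Suc j) * (Suc j * r)"
      unfolding T_def binomial_ratio[OF that, symmetric] by (simp only: ac_simps)
    finally show ?thesis by simp
  qed
  have up: "T j \<le> T (Suc j)" if j: "j < q" for j
  proof -
    have "m * Suc j \<le> m * q" using j by (intro mult_le_mono2) simp
    then have "int m * (int j + 1) \<le> int m * int q" by (metis of_nat_Suc of_nat_mult of_nat_le_iff add.commute)
    moreover have "int (m - j) = int q + int r - int j" "int m = int q + int r" using j m by auto
    ultimately have "int (Suc j * r) \<le> int ((m - j) * q)"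
      by (simp add: algebra_simps)
    then have "Suc j * r \<le> (m - j) * q" by (simp only: of_nat_le_iff)
    then have "T (Suc j) * (Suc j * r) \<le> T (Suc j) * ((m - j) * q)" by (rule mult_le_mono2)
    then have "T j * ((m - j) * q) \<le> T (Suc j) * ((m - j) * q)"
      using rec[of j] j m by linarith
    then show ?thesis using j m by simp
  qed
  have down: "T (Suc j) \<le> T j" if j: "q \<le> j" "j < m" for j
  proof -
    have "m * q \<le> m * j" using j by (intro mult_le_mono2) simp
    then have "int m * int q \<le> int m * int j" by (metis of_nat_mult of_nat_le_iff)
    moreover have "int (m - j) = int q + int r - int j" "int m = int q + int r" using j m by auto
    ultimately have "int ((m - j) * q) \<le> int (Suc j * r)"
      using j by (simp add: algebra_simps)
    then have "(m - j) * q \<le> Suc j * r" by (simp only: of_nat_le_iff)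
    then have "T j * ((m - j) * q) \<le> T j * (Suc j * r)" by (rule mult_le_mono2)
    then have "T (Suc j) * (Suc j * r) \<le> T j * (Suc j * r)" using rec[of j] j by linarith
    then show ?thesis using j m by simp
  qed
  have max: "T j \<le> T q" if "j \<le> m" for j
  proof (cases "j \<le> q")
    case True
    then show ?thesis by (induction rule: inc_induct) (auto intro: order_trans up)
  next
    case False
    then have "q \<le> j" by simp
    then show ?thesis using that
    proof (induction rule: dec_induct)
      case (step n)
      then show ?case using down[of n] by simp
    qed simp
  qed
  have "m ^ m = (q + r) ^ m" by (simp add: m)
  also have "\<dots> = (\<Sum>j\<le>m. T j)" unfolding T_def by (simp only: binomial of_nat_id)
  also have "\<dots> \<le> (\<Sum>j\<le>m. T q)" by (intro sum_mono max) simp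
  also have "\<dots> = (m + 1) * T q" by simp
  finally show ?thesis by (simp add: T_def r_def)
qed

definition bin_entropy :: "real \<Rightarrow> real" where
  "bin_entropy x = - x * ln x - (1 - x) * ln (1 - x)"

lemma exp_entropy_le_binomial:
  assumes "0 < q" "q < m"
  shows "exp (real m * bin_entropy (real q / real m)) \<le> real (m + 1) * real (m choose q)"
proof -
  define r where "r = m - q"
  have r: "r > 0" "real m = real q + real r" using assms by (auto simp: r_def)
  have m: "m > 0" using assms by simp
  have "1 - real q / real m = real r / real m" using r m by (simp add: field_simps)
  then have "bin_entropy (real q / real m) = - (real q / real m) * (ln q - ln m) - (real r / real m) * (ln r - ln m)"
    using assms r m by (simp add: bin_entropy_def ln_div)
  moreover have "real m * (- (real q / real m) * A - (real r / real m) * B) = - real q * A - real r * B" for A B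
    using m by (simp add: right_diff_distrib)
  ultimately have "real m * bin_entropy (real q / real m) = - real q * (ln q - ln m) - real r * (ln r - ln m)"
    by presburger
  then have "real m * bin_entropy (real q / real m) = (real q + real r) * ln m - real q * ln q - real r * ln r"
    by (simp add: algebra_simps)
  also have "\<dots> = real m * ln m - real q * ln q - real r * ln r" by (simp only: r(2))
  also have "exp \<dots> = real m ^ m / (real q ^ q * real r ^ r)"
    using assms r(1) m by (simp add: exp_diff exp_of_nat_mult)
  also have "\<dots> \<le> real (m + 1) * real (m choose q)"
  proof -
    have "real (m ^ m) \<le> real ((m + 1) * ((m choose q) * q ^ q * r ^ r))"
      unfolding r_def of_nat_le_iff using assms by (intro pow_self_le_binomial) simp
    then show ?thesis using assms r by (simp add: field_simps)
  qed
  finally show ?thesis .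
qed

text \<open>The exponential rate in \<open>m\<close>, at q = x m, of the layer size C(m, q) 4^q
  against the bound (1 + 2 z + 2 z^2)^m / z^q from \<open>card_exponents_le\<close>.\<close>

definition growth :: "real \<Rightarrow> real \<Rightarrow> real" where
  "growth z x = bin_entropy x + x * ln (4 * z) - ln (1 + 2 * z + 2 * z\<^sup>2)"

text \<open>Entropy is concave and the other terms are affine in \<open>x\<close>. A lower bound for
  \<open>growth z\<close> therefore needs checking only at the ends of an interval.\<close>

lemma convex_neg_growth: "convex_on {0<..<1} (\<lambda>x. - growth z x)"
proof (rule f''_ge0_imp_convex)
  fix x :: real assume x: "x \<in> {0<..<1}"
  show "((\<lambda>x. - growth z x) has_real_derivative ln x - ln (1 - x) - ln (4 * z)) (at x)"
  proof -
    have "((\<lambda>x. x * ln x) has_real_derivative ln x + 1) (at x)"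
      using x by (auto intro!: derivative_eq_intros)
    moreover have "((\<lambda>x. (1 - x) * ln (1 - x)) has_real_derivative - ln (1 - x) - 1) (at x)"
      using x by (auto intro!: derivative_eq_intros)
    moreover have "((\<lambda>x. ln (1 + 2 * z + 2 * z\<^sup>2) - x * ln (4 * z)) has_real_derivative - ln (4 * z)) (at x)"
      by (auto intro!: derivative_eq_intros)
    ultimately have "((\<lambda>x. x * ln x + ((1 - x) * ln (1 - x) + (ln (1 + 2 * z + 2 * z\<^sup>2) - x * ln (4 * z))))
        has_real_derivative (ln x + 1) + ((- ln (1 - x) - 1) + - ln (4 * z))) (at x)"
      by (intro DERIV_add)
    moreover have "(\<lambda>x. - growth z x)
        = (\<lambda>x. x * ln x + ((1 - x) * ln (1 - x) + (ln (1 + 2 * z + 2 * z\<^sup>2) - x * ln (4 * z))))"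
      by (simp add: growth_def bin_entropy_def fun_eq_iff)
    ultimately have "((\<lambda>x. - growth z x) has_real_derivative
        (ln x + 1) + ((- ln (1 - x) - 1) + - ln (4 * z))) (at x)" by (simp only:)
    then show ?thesis by (rule DERIV_cong) simp
  qed
  show "((\<lambda>x. ln x - ln (1 - x) - ln (4 * z)) has_real_derivative 1 / x + 1 / (1 - x)) (at x)"
    using x by (auto intro!: derivative_eq_intros)
  show "0 \<le> 1 / x + 1 / (1 - x)" using x by simp
qed (rule convex_real_interval)

lemma growth_ge_between:
  assumes "0 < a" "b < 1" "a \<le> x" "x \<le> b" "c \<le> growth z a" "c \<le> growth z b"
  shows "c \<le> growth z x"
proof (cases "a = b")
  case False
  define v where "v = (x - a) / (b - a)"
  have v: "0 \<le> v" "v \<le> 1" using assms False by (auto simp: v_def field_simps)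
  have "v * (b - a) = x - a" using False by (simp add: v_def)
  then have x: "x = (1 - v) *\<^sub>R a + v *\<^sub>R b" by (simp add: algebra_simps)
  have "- growth z x \<le> max (- growth z a) (- growth z b)"
    unfolding x using assms v by (intro convex_lower[OF convex_neg_growth]) auto
  then show ?thesis using assms by auto
qed (use assms in auto)

text \<open>The conclusion multiplied by \<open>n\<close> and exponentiated: for rational
  \<open>z\<close> and \<open>c\<close> the last hypothesis is settled by evaluation.\<close>

lemma growth_ge_rational:
  fixes a n :: nat
  assumes "0 < a" "a < n" "0 < z" "0 < c"
    and "c ^ n * real a ^ a * real (n - a) ^ (n - a) * (1 + 2 * z + 2 * z\<^sup>2) ^ n \<le> real n ^ n * (4 * z) ^ a"
  shows "ln c \<le> growth z (real a / real n)"
proof -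
  define w where "w = 1 + 2 * z + 2 * z\<^sup>2"
  define b where "b = n - a"
  have b: "b > 0" "real n = real a + real b" using assms by (auto simp: b_def)
  have n: "n > 0" using assms by simp
  have w: "w > 0" using assms by (simp add: w_def add_pos_nonneg)
  have "ln (c ^ n * real a ^ a * real b ^ b * w ^ n) \<le> ln (real n ^ n * (4 * z) ^ a)"
  proof (rule ln_mono)
    show "0 < c ^ n * real a ^ a * real b ^ b * w ^ n" using assms(1-4) b(1) w by simp
    show "c ^ n * real a ^ a * real b ^ b * w ^ n \<le> real n ^ n * (4 * z) ^ a"
      using assms(5) by (simp only: w_def b_def)
  qed
  then have le: "real n * ln c + real a * ln a + real b * ln b + real n * ln w \<le> real n * ln n + real a * ln (4 * z)"
    using assms(1-4) b(1) w n by (simp add: ln_mult_pos ln_realpow power_mult_distrib distrib_left)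
  have "1 - real a / real n = real b / real n" using b n by (simp add: field_simps)
  then have "growth z (real a / real n) = - (real a / real n) * (ln a - ln n) - (real b / real n) * (ln b - ln n)
      + (real a / real n) * ln (4 * z) - ln w"
    using assms b n by (simp add: growth_def bin_entropy_def ln_div w_def)
  moreover have "real n * (- (real a / real n) * A - (real b / real n) * B + (real a / real n) * C - E)
      = - real a * A - real b * B + real a * C - real n * E" for A B C E
    using n by (simp add: right_diff_distrib distrib_left)
  ultimately have "real n * growth z (real a / real n)
      = - real a * (ln a - ln n) - real b * (ln b - ln n) + real a * ln (4 * z) - real n * ln w"
    by presburger
  also have "\<dots>
      = (real a + real b) * ln n - real a * ln a - real b * ln b + real a * ln (4 * z) - real n * ln w"
    by (simp add: algebra_simps)
  also have "\<dots> = real n * ln n - real a * ln a - real b * ln b + real a * ln (4 * z) - real n * ln w"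
    by (simp only: b(2))
  finally have "real n * ln c \<le> real n * growth z (real a / real n)" using le by linarith
  then show ?thesis using n by simp
qed

text \<open>One \<open>z\<close> for each of three subintervals suffices; the outer ends 5/19 and
  15/19 are the tight points. The value 722/625 = 1.1552 leaves a margin above 1.155.\<close>

lemma growth_ge:
  assumes "5 / 19 \<le> x" "x \<le> 15 / 19"
  shows "\<exists>z. 0 < z \<and> z \<le> 1 \<and> ln (722 / 625) \<le> growth z x"
proof -
  have g1: "ln (722 / 625) \<le> growth (3 / 20) (real 5 / real 19)"
    by (rule growth_ge_rational) (simp_all add: power_divide power2_eq_square)
  have g2: "ln (722 / 625) \<le> growth (3 / 20) (real 9 / real 19)"
    by (rule growth_ge_rational) (simp_all add: power_divide power2_eq_square)
  have g3: "ln (722 / 625) \<le> growth (1 / 4) (real 9 / real 19)"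
    by (rule growth_ge_rational) (simp_all add: power_divide power2_eq_square)
  have g4: "ln (722 / 625) \<le> growth (1 / 4) (real 10 / real 19)"
    by (rule growth_ge_rational) (simp_all add: power_divide power2_eq_square)
  have g5: "ln (722 / 625) \<le> growth (7 / 15) (real 10 / real 19)"
    by (rule growth_ge_rational) (simp_all add: power_divide power2_eq_square)
  have g6: "ln (722 / 625) \<le> growth (7 / 15) (real 15 / real 19)"
    by (rule growth_ge_rational) (simp_all add: power_divide power2_eq_square)
  consider "x \<le> 9 / 19" | "9 / 19 \<le> x" "x \<le> 10 / 19" | "10 / 19 \<le> x" by linarith
  then show ?thesis
  proof cases
    case 1
    then have "ln (722 / 625) \<le> growth (3 / 20) x"
      using growth_ge_between[of "5 / 19" "9 / 19" x _ "3 / 20"] g1 g2 assms by simp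
    then show ?thesis by (intro exI[of _ "3 / 20"]) simp
  next
    case 2
    then have "ln (722 / 625) \<le> growth (1 / 4) x"
      using growth_ge_between[of "9 / 19" "10 / 19" x _ "1 / 4"] g3 g4 by simp
    then show ?thesis by (intro exI[of _ "1 / 4"]) simp
  next
    case 3
    then have "ln (722 / 625) \<le> growth (7 / 15) x"
      using growth_ge_between[of "10 / 19" "15 / 19" x _ "7 / 15"] g5 g6 assms by simp
    then show ?thesis by (intro exI[of _ "7 / 15"]) simp
  qed
qed

section \<open>Choice of the parameters and the numerical constants\<close>

lemma exists_power3_between:
  assumes "4 \<le> m"
  shows "\<exists>e. 5 * m \<le> 19 * 3 ^ e \<and> 19 * 3 ^ e \<le> 15 * (m::nat)"
proof -
  define e where "e = (LEAST e. 5 * m \<le> 19 * 3 ^ e)"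
  have "m < 3 ^ m" by (rule less_exp[THEN less_le_trans]) (simp add: power_mono)
  then have "5 * m \<le> 19 * 3 ^ m" by linarith
  then have e: "5 * m \<le> 19 * 3 ^ e" unfolding e_def by (rule LeastI)
  \<comment> \<open>For m at least 4, \<open>5 * m\<close> exceeds 19, so there is a preceding power
    of 3; it lies below \<open>5 * m / 19\<close>, which yields the upper bound.\<close>
  have "e \<noteq> 0" using e assms by (intro notI) simp
  then obtain e' where e': "e = Suc e'" by (cases e) auto
  have "\<not> 5 * m \<le> 19 * 3 ^ e'" using not_less_Least[of e' "\<lambda>e. 5 * m \<le> 19 * 3 ^ e"] e' by (simp add: e_def)
  then show ?thesis using e by (intro exI[of _ e]) (simp add: e')
qed

text \<open>The factor \<open>m + 1\<close> is lost in the entropy bound and 4 in the choice of a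
  sign class; the gap between 1.1552 and 1.155 pays for both.\<close>

lemma eventually_growth:
  "eventually (\<lambda>m. 4 * (real m + 1) * (231 / 200) ^ m \<le> (722 / 625) ^ m) sequentially"
  by real_asymp

lemma sign_class_large:
  assumes "0 < q" "q < m" "5 * m \<le> 19 * q" "19 * q \<le> 15 * m"
    and m: "4 * (real m + 1) * (231 / 200) ^ m \<le> (722 / 625) ^ m"
  shows "\<exists>r s. (231 / 200) ^ m * real (card (exponents m (q - 1))) \<le> real (card (sign_class m q r s))"
proof -
  define x where "x = real q / real m"
  have x: "5 / 19 \<le> x" "x \<le> 15 / 19" using assms by (auto simp: x_def field_simps)
  obtain z where z: "0 < z" "z \<le> 1" "ln (722 / 625) \<le> growth z x" using growth_ge[OF x] by blast
  define w where "w = 1 + 2 * z + 2 * z\<^sup>2"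
  define \<alpha> where "\<alpha> = real (card (exponents m (q - 1)))"
  define C where "C = real (m choose q)"
  have w: "w > 0" using z by (simp add: w_def add_pos_nonneg)
  \<comment> \<open>Since \<open>z \<le> 1\<close>, the degree \<open>q - 1\<close> may be relaxed
    to \<open>q\<close>, so that \<open>z ^ q\<close> cancels later.\<close>
  have "\<alpha> * z ^ q \<le> \<alpha> * z ^ (q - 1)"
    using z by (intro mult_left_mono power_decreasing) (auto simp: \<alpha>_def)
  also have "\<dots> \<le> w ^ m" unfolding \<alpha>_def w_def using z by (intro card_exponents_le)
  finally have \<alpha>: "\<alpha> * z ^ q \<le> w ^ m" .
  have "(722 / 625) ^ m = exp (real m * ln (722 / 625))" by (simp add: exp_of_nat_mult)
  also have "\<dots> \<le> exp (real m * growth z x)" using z(3) by (simp add: mult_left_mono)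
  also have "real m * growth z x = real m * bin_entropy x + real q * ln (4 * z) - real m * ln w"
    using assms by (simp add: growth_def x_def w_def distrib_left right_diff_distrib)
  also have "exp \<dots> = exp (real m * bin_entropy x) * (4 * z) ^ q / w ^ m"
    using z w by (simp add: exp_diff exp_add exp_of_nat_mult)
  also have "\<dots> \<le> real (m + 1) * C * (4 * z) ^ q / w ^ m"
    using exp_entropy_le_binomial[OF assms(1,2)] z w unfolding x_def C_def
    by (intro divide_right_mono mult_right_mono) auto
  finally have "(722 / 625) ^ m * w ^ m \<le> real (m + 1) * C * (4 * z) ^ q"
    using w by (simp add: pos_le_divide_eq)
  moreover have "(722 / 625) ^ m * (\<alpha> * z ^ q) \<le> (722 / 625) ^ m * w ^ m"
    using \<alpha> by (intro mult_left_mono) auto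
  ultimately have "(722 / 625) ^ m * (\<alpha> * z ^ q) \<le> real (m + 1) * C * (4 * z) ^ q"
    by (rule order_trans[rotated])
  then have "((722 / 625) ^ m * \<alpha>) * z ^ q \<le> (real (m + 1) * C * 4 ^ q) * z ^ q"
    by (simp only: power_mult_distrib mult.assoc)
  then have "(722 / 625) ^ m * \<alpha> \<le> real (m + 1) * C * 4 ^ q" using z(1) by simp
  moreover have "4 * (real m + 1) * (231 / 200) ^ m * \<alpha> \<le> (722 / 625) ^ m * \<alpha>"
    using m by (intro mult_right_mono) (auto simp: \<alpha>_def)
  ultimately have "4 * (real m + 1) * (231 / 200) ^ m * \<alpha> \<le> (real m + 1) * C * 4 ^ q"
    by (simp only: of_nat_add of_nat_1)
  then have "(real m + 1) * (4 * ((231 / 200) ^ m * \<alpha>)) \<le> (real m + 1) * (C * 4 ^ q)"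
    by (simp only: ac_simps)
  then have main: "4 * ((231 / 200) ^ m * \<alpha>) \<le> C * 4 ^ q"
    by (rule mult_left_le_imp_le) simp
  obtain r s where "card (layer m q) \<le> 4 * card (sign_class m q r s)"
    using exists_large_sign_class by blast
  then have "real ((m choose q) * 4 ^ q) \<le> real (4 * card (sign_class m q r s))"
    unfolding card_layer by (simp only: of_nat_le_iff)
  then have "C * 4 ^ q \<le> 4 * real (card (sign_class m q r s))" by (simp add: C_def)
  with main show ?thesis unfolding \<alpha>_def by (intro exI[of _ r] exI[of _ s]) linarith
qed

text \<open>17/12 is a convergent of sqrt 2 from above. Taking twelfth powers reduces the comparison
  to 1.107^17 <= 1.155^12.\<close>

lemma powr_sqrt_le_power:
  assumes "sqrt (real d) \<le> 17 / 12 * real m"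
  shows "1.107 powr sqrt (real d) \<le> (231 / 200) ^ m"
proof -
  have pw: "((1107 / 1000 :: real) powr (17 / 12)) ^ n = (1107 / 1000) powr (17 / 12 * real n)" for n
  proof -
    have "((1107 / 1000 :: real) powr (17 / 12)) powr real n = ((1107 / 1000) powr (17 / 12)) ^ n"
      by (rule powr_realpow) simp
    then show ?thesis by (simp only: powr_powr)
  qed
  have "(1107 / 1000 :: real) powr (17 / 12) \<le> 231 / 200"
  proof (rule power_le_imp_le_base)
    have "((1107 / 1000 :: real) powr (17 / 12)) ^ Suc 11 = (1107 / 1000) powr (17 / 12 * real (Suc 11))"
      by (rule pw)
    also have "17 / 12 * real (Suc 11) = real 17" by simp
    also have "(1107 / 1000 :: real) powr real 17 = (1107 / 1000) ^ 17" by (rule powr_realpow) simp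
    also have "\<dots> \<le> (231 / 200) ^ Suc 11" by (simp add: power_divide)
    finally show "((1107 / 1000 :: real) powr (17 / 12)) ^ Suc 11 \<le> (231 / 200) ^ Suc 11" .
  qed simp
  then have base: "((1107 / 1000 :: real) powr (17 / 12)) ^ m \<le> (231 / 200) ^ m"
    by (intro power_mono) auto
  have "(1107 / 1000 :: real) powr sqrt (real d) \<le> (1107 / 1000) powr (17 / 12 * real m)"
    using assms by (intro powr_mono) auto
  also have "\<dots> = ((1107 / 1000 :: real) powr (17 / 12)) ^ m"
    by (rule pw[symmetric])
  finally show ?thesis using base by simp
qed

text \<open>With \<open>m\<close> about 12/17 of sqrt d, the leading term
  \<open>2 * m\<^sup>2\<close> is about 288/289 of \<open>d\<close>; the remaining 1/289 covers the
  lower-order terms once sqrt d is at least 2000.\<close>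

lemma exists_dimension_split:
  assumes "sqrt (real d) \<ge> 2000"
  shows "\<exists>m. sqrt (real d) \<le> 17 / 12 * real m \<and> m * (2 * m + 1) \<le> d"
proof -
  define t where "t = sqrt (real d)"
  define m where "m = nat \<lceil>12 / 17 * t\<rceil>"
  have t: "t \<ge> 2000" "t\<^sup>2 = real d" using assms by (auto simp: t_def)
  have m: "12 / 17 * t \<le> real m" "real m \<le> 12 / 17 * t + 1"
    using t(1) unfolding m_def by linarith+
  have "real m * (2 * real m + 1) \<le> (12 / 17 * t + 1) * (2 * (12 / 17 * t + 1) + 1)"
    using m t by (intro mult_mono) auto
  also have "\<dots> = 288 / 289 * t\<^sup>2 + 60 / 17 * t + 3" by (simp add: power2_eq_square algebra_simps)
  also have "\<dots> \<le> t\<^sup>2"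
  proof -
    have "2000 * t \<le> t * t" using t by (intro mult_right_mono) auto
    then show ?thesis unfolding power2_eq_square using t(1) by linarith
  qed
  finally have "real (m * (2 * m + 1)) \<le> real d"
    unfolding t(2) by (simp only: of_nat_mult of_nat_add of_nat_numeral of_nat_1)
  then have "m * (2 * m + 1) \<le> d" by (simp only: of_nat_le_iff)
  then show ?thesis using m(1) by (intro exI[of _ m]) (simp add: t_def)
qed

lemma exists_diameter_graph:
  obtains d0 where "\<And>d g. d0 \<le> d \<Longrightarrow> 0 < g \<Longrightarrow>
    \<exists>V E. finite V \<and> simple_graph V E \<and> diameter_graph d V E \<and> girth_ge V E g \<and>
      1.107 powr sqrt (real d) \<le> real (chromatic_number V E)"
proof -
  obtain m0 where m0: "\<And>m. m \<ge> m0 \<Longrightarrow> 4 * (real m + 1) * (231 / 200) ^ m \<le> (722 / 625) ^ m"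
    using eventually_growth unfolding eventually_sequentially by blast
  show ?thesis
  \<comment> \<open>2000 serves \<open>exists_dimension_split\<close>; \<open>2 * m0\<close> gives
    \<open>m \<ge> m0\<close>, since \<open>m\<close> is at least 12/17 of sqrt d.\<close>
  proof (rule that[of "(2000 + 2 * m0)\<^sup>2"])
    fix d g :: nat assume d: "(2000 + 2 * m0)\<^sup>2 \<le> d" and g: "0 < g"
    have "real ((2000 + 2 * m0)\<^sup>2) \<le> real d" using d by (simp only: of_nat_le_iff)
    then have "(real (2000 + 2 * m0))\<^sup>2 \<le> real d" by (simp only: of_nat_power)
    then have sd: "real (2000 + 2 * m0) \<le> sqrt (real d)" by (rule real_le_rsqrt)
    then obtain m where m: "sqrt (real d) \<le> 17 / 12 * real m" "m * (2 * m + 1) \<le> d"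
      using exists_dimension_split[of d] by auto
    have mbig: "m \<ge> 4" "m \<ge> m0" using sd m(1) by linarith+
    obtain e where e: "5 * m \<le> 19 * 3 ^ e" "19 * 3 ^ e \<le> 15 * m"
      using exists_power3_between[OF mbig(1)] by blast
    define q :: nat where "q = 3 ^ e"
    have q: "0 < q" "q < m" "odd q" "int q = 3 ^ e" using e mbig(1) by (auto simp: q_def)
    define B where "B = 1.107 powr sqrt (real d)"
    define \<alpha> where "\<alpha> = card (exponents m (q - 1))"
    obtain r s where rs: "(231 / 200) ^ m * real \<alpha> \<le> real (card (sign_class m q r s))"
      unfolding \<alpha>_def using sign_class_large[OF q(1,2) _ _ m0[OF mbig(2)]] e by (auto simp: q_def)
    have \<alpha>: "\<alpha> > 0"
    proof -
      have "(\<lambda>i\<in>{..<m}. 0) \<in> exponents m (q - 1)" by (auto simp: exponents_def deg1_def)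
      then show ?thesis unfolding \<alpha>_def using finite_exponents by (auto simp: card_gt_0_iff)
    qed
    have "B * real \<alpha> \<le> (231 / 200) ^ m * real \<alpha>"
      unfolding B_def using powr_sqrt_le_power[OF m(1)] by (intro mult_right_mono) auto
    with rs have BX: "B * real \<alpha> \<le> real (card (sign_class m q r s))" by linarith
    have "0 < sqrt (real d)" using sd by linarith
    then have B1: "B > 1" unfolding B_def by (intro gr_one_powr) auto
    \<comment> \<open>The largest integer strictly below \<open>B\<close>: strict, so that
      \<open>k * \<alpha>\<close> stays below the class size; largest, so that more than
      \<open>k\<close> colours means at least \<open>B\<close>.\<close>
    define k where "k = nat \<lceil>B\<rceil> - 1"
    have k: "k > 0" "real k < B" "B \<le> real (k + 1)" using B1 unfolding k_def by linarith+
    have "real k * real \<alpha> < B * real \<alpha>" using k \<alpha> by (intro mult_strict_right_mono) auto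
    with BX have "real (k * \<alpha>) < real (card (sign_class m q r s))" by simp
    then have kX: "k * \<alpha> < card (sign_class m q r s)" by (simp only: of_nat_less_iff)
    have "prime (3::int)" by simp
    then obtain V E where VE: "finite V" "simple_graph V E" "diameter_graph d V E" "girth_ge V E g"
      "k < chromatic_number V E"
      using sign_class_diameter_graph[OF _ q(4,3) k(1) kX[unfolded \<alpha>_def] m(2) g] by blast
    have "B \<le> real (chromatic_number V E)" using k(3) VE(5) by linarith
    then show "\<exists>V E. finite V \<and> simple_graph V E \<and> diameter_graph d V E \<and> girth_ge V E g \<and>
      1.107 powr sqrt (real d) \<le> real (chromatic_number V E)"
      using VE unfolding B_def by blast
  qed
qed

theorem theorem1p2:
  shows "\<exists>\<epsilon> :: nat \<Rightarrow> real. \<epsilon> \<longlonglongrightarrow> 0 \<and>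
    (\<forall>g::nat. g \<ge> 3 \<longrightarrow> (\<forall>d::nat. d > 0 \<longrightarrow>
      (\<exists>V E. finite V \<and> simple_graph V E \<and> diameter_graph d V E \<and> girth_ge V E g \<and>
         real (chromatic_number V E) \<ge> (1.107 + \<epsilon> d) powr sqrt (real d))))"
proof -
  obtain d0 where d0: "\<And>d g. d0 \<le> d \<Longrightarrow> 0 < g \<Longrightarrow>
    \<exists>V E. finite V \<and> simple_graph V E \<and> diameter_graph d V E \<and> girth_ge V E g \<and>
      1.107 powr sqrt (real d) \<le> real (chromatic_number V E)"
    using exists_diameter_graph by blast
  \<comment> \<open>Below \<open>d0\<close> the base becomes 0 and \<open>0 powr _\<close> is 0, so
    the empty graph serves; from \<open>d0\<close> on the correction is 0.\<close>
  define \<epsilon> :: "nat \<Rightarrow> real" where "\<epsilon> d = (if d < d0 then - 1.107 else 0)" for d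
  have "eventually (\<lambda>d. \<epsilon> d = 0) sequentially"
    using eventually_ge_at_top[of d0] by eventually_elim (simp add: \<epsilon>_def)
  then have "\<epsilon> \<longlonglongrightarrow> 0" by (rule tendsto_eventually)
  moreover have "\<exists>V E. finite V \<and> simple_graph V E \<and> diameter_graph d V E \<and> girth_ge V E g \<and>
         real (chromatic_number V E) \<ge> (1.107 + \<epsilon> d) powr sqrt (real d)" if "g \<ge> 3" for g d :: nat
  proof (cases "d < d0")
    case True
    have "diameter_graph d {} (\<lambda>_ _. False)" "girth_ge {} (\<lambda>_ _. False) g" "simple_graph {} (\<lambda>_ _. False)"
      by (auto simp: diameter_graph_def girth_ge_def is_cycle_def simple_graph_def)
    moreover have "(1.107 + \<epsilon> d) powr sqrt (real d) \<le> real (chromatic_number {} (\<lambda>_ _. False))"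
      using True by (simp add: \<epsilon>_def)
    ultimately show ?thesis by blast
  next
    case False
    then show ?thesis using d0[of d g] that by (simp add: \<epsilon>_def)
  qed
  ultimately show ?thesis by blast
qed

end
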